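(* Let $m\ge1$ be an integer. Suppose that $\lambda^jr(\lambda^{-1})\in H^1_\lambda$ for all integers $-1\le j\le m+1$ and that $$\|\lambda^{-1}r(1/\lambda)\|_{L^2_\lambda}+\|r(1/\lambda)\|_{L^2_\lambda}$$ is sufficiently small. For $t\ge0$ let $q_{\mathcal H}(\cdot,t)\in X_m(dx_{\mathcal H})$ be the function determined by $$\frac{q_{\mathcal H}}{\sqrt{1+|q_{\mathcal H}|^2}}=\partial_{x_{\mathcal H}}m^{(1)}_{12},$$ where $m^{(1)}_{12}=m^{(1)}_{12}(x_{\mathcal H},t)$ is obtained from $r$ through the Riemann-Hilbert problem described in the context. For each $t\ge0$ let $\epsilon(\cdot,t)$ be the unique monotone increasing bounded continuous solution, with $\epsilon(-\infty,t)=0$, of $$\epsilon(x,t)=\int_{-\infty}^x\Big(\sqrt{1+|q_{\mathcal H}(y+\epsilon(y,t),t)|^2}-1\Big)dy ,$$ and let the variable $x$ be determined from $x_{\mathcal H}$ by $x_{\mathcal H}=x+\epsilon(x,t)$. Then $$q(x,t)=q_{\mathcal H}\big(x+\epsilon(x,t),t\big)$$ belongs to $X_m(\mathbb R)$ (as a function of $x$) for every $t\ge0$.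
   Context: Notation: $\langle x\rangle=\sqrt{1+x^2}$; $X_m=\{f\in L^2(\mathbb R):\langle x\rangle\partial_x^jf\in L^2(\mathbb R),\ j=0,\dots,m\}$ (complex-valued functions, weak derivatives), and $X_m(dx_{\mathcal H})$ is the same space in the variable $x_{\mathcal H}\in\mathbb R$; $H^1_\lambda$ and $L^2_\lambda$ are the usual spaces on $\mathbb R$ in the variable $\lambda$. Here $r$ is a complex-valued function on $\mathbb R$ (the reflection coefficient, a function of $z$), and its regularity is measured through $\lambda\mapsto\lambda^jr(1/\lambda)$. Riemann-Hilbert problem: for real $x_{\mathcal H}$ and $t\ge0$ put $\theta(z)=\frac{x_{\mathcal H}}{z}+\frac{2t}{z^2}$ ($z\in\mathbb R$) and $$w_{\theta+}=\begin{pmatrix}0&0\\ r(z)e^{2i\theta(z)}&0\end{pmatrix},\qquad w_{\theta-}=\begin{pmatrix}0&\overline{r(z)}e^{-2i\theta(z)}\\0&0\end{pmatrix}.$$ Let $C^\pm$ be the boundary values on $\mathbb R$, from the upper ($+$) and lower ($-$) half planes, of the Cauchy operator $(C\phi)(z)=\frac1{2\pi i}\int_{\mathbb R}\frac{\phi(s)}{s-z}ds$, and set $C_{w_\theta}\phi=C^+(\phi w_{\theta-})+C^-(\phi w_{\theta+})$ for $2\times2$ matrix functions $\phi$. The operator $I-C_{w_\theta}$ is invertible on $L^2(\mathbb R)$, and $\mu=\mu(z;x_{\mathcal H},t)$ denotes the unique solution of $\mu=I+C_{w_\theta}\mu$ with $\mu-I\in L^2(dz)$. The matrix $m(z)=I+C(\mu(w_{\theta+}+w_{\theta-}))$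 satisfies $m_+=m_-\begin{pmatrix}1+|r|^2&\bar re^{-2i\theta}\\ re^{2i\theta}&1\end{pmatrix}$ on $\mathbb R$ and $m\to I$ at infinity. With $m^{(1)}$ the coefficient of $1/z$ of $m$ at infinity, $$\partial_{x_{\mathcal H}}m^{(1)}_{12}=-\frac1{2\pi i}\,\partial_{x_{\mathcal H}}\int_{\mathbb R}\big[\mu(w_{\theta-}+w_{\theta+})\big]_{12}ds .$$ Under the hypotheses of the claim one has $|\partial_{x_{\mathcal H}}m^{(1)}_{12}|<1$, so that $q_{\mathcal H}$ is determined, and it belongs to $X_m$ for every $t\ge0$; the solution $\epsilon(\cdot,t)$ exists and is unique. *)

theory Defs
  imports "HOL-Analysis.Analysis"
begin

section \<open>Function spaces on the real line\<close>

definition L2 :: "(real \<Rightarrow> complex) set" where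
  "L2 = {f. f \<in> borel_measurable lebesgue \<and> integrable lebesgue (\<lambda>x. (cmod (f x))\<^sup>2)}"

definition L2_norm :: "(real \<Rightarrow> complex) \<Rightarrow> real" where
  "L2_norm f = sqrt (\<integral>x. (cmod (f x))\<^sup>2 \<partial>lebesgue)"

text \<open>Real-valued test functions suffice for complex-valued \<open>f\<close>, by linearity.\<close>

definition test_function :: "(real \<Rightarrow> real) \<Rightarrow> bool" where
  "test_function \<phi> \<longleftrightarrow>
     (\<forall>n. (deriv ^^ n) \<phi> differentiable_on UNIV) \<and> compact (closure {x. \<phi> x \<noteq> 0})"

definition locally_integrable :: "(real \<Rightarrow> complex) \<Rightarrow> bool" where
  "locally_integrable f \<longleftrightarrow> (\<forall>a b. set_integrable lebesgue {a..b} f)"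

definition is_weak_deriv :: "nat \<Rightarrow> (real \<Rightarrow> complex) \<Rightarrow> (real \<Rightarrow> complex) \<Rightarrow> bool" where
  "is_weak_deriv j f g \<longleftrightarrow> locally_integrable f \<and> locally_integrable g \<and>
     (\<forall>\<phi>. test_function \<phi> \<longrightarrow>
        (\<integral>x. f x * of_real ((deriv ^^ j) \<phi> x) \<partial>lebesgue) =
        (-1) ^ j * (\<integral>x. g x * of_real (\<phi> x) \<partial>lebesgue))"

definition H1 :: "(real \<Rightarrow> complex) set" where
  "H1 = {f \<in> L2. \<exists>g. is_weak_deriv 1 f g \<and> g \<in> L2}"

definition X_space :: "nat \<Rightarrow> (real \<Rightarrow> complex) set" where
  "X_space m = {f \<in> L2. \<forall>j\<le>m. \<exists>g. is_weak_deriv j f g \<and>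
                        (\<lambda>x. of_real (sqrt (1 + x\<^sup>2)) * g x) \<in> L2}"


section \<open>The Riemann-Hilbert problem\<close>

definition cauchy :: "(real \<Rightarrow> complex) \<Rightarrow> complex \<Rightarrow> complex" where
  "cauchy \<phi> z = 1 / (2 * of_real pi * \<i>) * (\<integral>s. \<phi> s / (of_real s - z) \<partial>lebesgue)"

text \<open>For \<open>\<phi>\<close> in \<open>L2\<close> the following vertical limits exist almost everywhere and agree with the
  nontangential boundary values; elsewhere the value is irrelevant.\<close>

definition cauchy_plus :: "(real \<Rightarrow> complex) \<Rightarrow> real \<Rightarrow> complex" where
  "cauchy_plus \<phi> x = Lim (at_right 0) (\<lambda>\<epsilon>::real. cauchy \<phi> (of_real x + \<i> * of_real \<epsilon>))"

definition cauchy_minus :: "(real \<Rightarrow> complex) \<Rightarrow> real \<Rightarrow> complex" where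
  "cauchy_minus \<phi> x = Lim (at_right 0) (\<lambda>\<epsilon>::real. cauchy \<phi> (of_real x - \<i> * of_real \<epsilon>))"

definition entrywise ::
  "((real \<Rightarrow> complex) \<Rightarrow> 'a \<Rightarrow> complex) \<Rightarrow> (real \<Rightarrow> complex^2^2) \<Rightarrow> 'a \<Rightarrow> complex^2^2" where
  "entrywise T \<phi> z = (\<chi> i k. T (\<lambda>s. \<phi> s $ i $ k) z)"

definition phase :: "real \<Rightarrow> real \<Rightarrow> real \<Rightarrow> real" where
  "phase x t z = x / z + 2 * t / z\<^sup>2"

definition w_plus :: "(real \<Rightarrow> complex) \<Rightarrow> real \<Rightarrow> real \<Rightarrow> real \<Rightarrow> complex^2^2" where
  "w_plus r x t z = vector [vector [0, 0],
                            vector [r z * exp (2 * \<i> * of_real (phase x t z)), 0]]"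

definition w_minus :: "(real \<Rightarrow> complex) \<Rightarrow> real \<Rightarrow> real \<Rightarrow> real \<Rightarrow> complex^2^2" where
  "w_minus r x t z = vector [vector [0, cnj (r z) * exp (- 2 * \<i> * of_real (phase x t z))],
                             vector [0, 0]]"

definition C_w :: "(real \<Rightarrow> complex) \<Rightarrow> real \<Rightarrow> real \<Rightarrow>
                   (real \<Rightarrow> complex^2^2) \<Rightarrow> real \<Rightarrow> complex^2^2" where
  "C_w r x t \<phi> z = entrywise cauchy_plus (\<lambda>s. \<phi> s ** w_minus r x t s) z
                 + entrywise cauchy_minus (\<lambda>s. \<phi> s ** w_plus r x t s) z"

definition RH_solution :: "(real \<Rightarrow> complex) \<Rightarrow> real \<Rightarrow> real \<Rightarrow> (real \<Rightarrow> complex^2^2) \<Rightarrow> bool" where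
  "RH_solution r x t \<mu> \<longleftrightarrow>
     (\<forall>i k. (\<lambda>z. (\<mu> z - mat 1) $ i $ k) \<in> L2) \<and>
     (AE z in lebesgue. \<mu> z = mat 1 + C_w r x t \<mu> z)"

definition RH_m :: "(real \<Rightarrow> complex) \<Rightarrow> real \<Rightarrow> real \<Rightarrow>
                    (real \<Rightarrow> complex^2^2) \<Rightarrow> complex \<Rightarrow> complex^2^2" where
  "RH_m r x t \<mu> z =
     mat 1 + entrywise cauchy (\<lambda>s. \<mu> s ** (w_plus r x t s + w_minus r x t s)) z"

text \<open>The coefficient of \<open>1/z\<close> at infinity is read off along the positive imaginary axis.  If
  \<open>r z\<close> decays only like \<open>c / z\<close>, the integral of \<open>\<mu> ** (w_plus + w_minus)\<close> does not converge
  absolutely and the coefficients seen from the upper and the lower half plane differ; the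
  difference does not depend on \<open>x\<close>, as \<open>phase\<close> vanishes at infinity, so the \<open>x\<close>-derivative
  is unambiguous.  In the absolutely convergent case the limit is the usual integral, see
  \<open>cauchy_coefficient\<close> below.\<close>

definition RH_m1 :: "(real \<Rightarrow> complex) \<Rightarrow> real \<Rightarrow> real \<Rightarrow>
                     (real \<Rightarrow> complex^2^2) \<Rightarrow> complex^2^2" where
  "RH_m1 r x t \<mu> =
     (\<chi> i k. Lim at_top (\<lambda>y::real. \<i> * of_real y *
                            (RH_m r x t \<mu> (\<i> * of_real y) - mat 1) $ i $ k))"

lemma cauchy_coefficient:
  assumes f: "integrable lebesgue f"
  shows "((\<lambda>y::real. \<i> * of_real y * cauchy f (\<i> * of_real y)) \<longlongrightarrow>
            - (1 / (2 * of_real pi * \<i>)) * (\<integral>s. f s \<partial>lebesgue)) at_top"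
proof -
  let ?g = "\<lambda>y s. f s * (\<i> * of_real y / (of_real s - \<i> * of_real y))"
  have lim: "((\<lambda>y. \<integral>s. ?g y s \<partial>lebesgue) \<longlongrightarrow> (\<integral>s. - f s \<partial>lebesgue)) at_top"
  proof (rule integral_dominated_convergence_at_top[where w = "\<lambda>s. norm (f s)"])
    show "integrable lebesgue (\<lambda>s. norm (f s))"
      using f by simp
    show "(\<lambda>s. - f s) \<in> borel_measurable lebesgue"
      using f by simp
    have cont: "(\<lambda>s. \<i> * of_real y / (of_real s - \<i> * of_real y)) \<in> borel_measurable lebesgue"
      for y :: real
      by (rule measurable_completion) measurable
    show "?g y \<in> borel_measurable lebesgue" for y
      using f cont by (intro borel_measurable_times) auto
    show "AE s in lebesgue. ((\<lambda>y. ?g y s) \<longlongrightarrow> - f s) at_top"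
    proof (rule AE_I2)
      fix s :: real
      have "((\<lambda>y::real. of_real s / of_real y :: complex) \<longlongrightarrow> 0) at_top"
        by (rule tendsto_divide_0[OF tendsto_const])
           (simp add: filterlim_at_infinity_conv_norm_at_top filterlim_abs_real)
      then have "((\<lambda>y::real. f s * (\<i> / (of_real s / of_real y - \<i>))) \<longlongrightarrow> f s * (\<i> / (0 - \<i>))) at_top"
        by (intro tendsto_intros) auto
      moreover have "\<forall>\<^sub>F y in at_top. f s * (\<i> / (of_real s / of_real y - \<i>)) = ?g y s"
        using eventually_gt_at_top[of "0::real"] by eventually_elim (auto simp: field_simps)
      ultimately show "((\<lambda>y. ?g y s) \<longlongrightarrow> - f s) at_top"
        by (auto elim: Lim_transform_eventually)
    qed
    have "norm (?g y s) \<le> norm (f s)" for y s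
    proof -
      have "\<bar>y\<bar> \<le> cmod (of_real s - \<i> * of_real y)"
        using abs_Im_le_cmod[of "of_real s - \<i> * of_real y"] by simp
      then have "cmod (\<i> * of_real y / (of_real s - \<i> * of_real y)) \<le> 1"
        by (simp add: norm_divide norm_mult divide_le_eq_1)
      from mult_left_mono[OF this, of "norm (f s)"] show ?thesis
        unfolding norm_mult by simp
    qed
    then show "\<forall>\<^sub>F y in at_top. AE s in lebesgue. norm (?g y s) \<le> norm (f s)"
      by simp
  qed
  have eq: "\<i> * of_real y * cauchy f (\<i> * of_real y) =
      1 / (2 * of_real pi * \<i>) * (\<integral>s. ?g y s \<partial>lebesgue)" for y
  proof -
    have "(\<integral>s. ?g y s \<partial>lebesgue) =
        (\<integral>s. (\<i> * of_real y) * (f s / (of_real s - \<i> * of_real y)) \<partial>lebesgue)"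
      by (rule Bochner_Integration.integral_cong) auto
    also have "\<dots> = \<i> * of_real y * (\<integral>s. f s / (of_real s - \<i> * of_real y) \<partial>lebesgue)"
      by (rule integral_mult_right_zero)
    finally show ?thesis
      by (simp only: cauchy_def mult_ac)
  qed
  show ?thesis
    unfolding eq using tendsto_mult_left[OF lim, of "1 / (2 * of_real pi * \<i>)"] by simp
qed


section \<open>The change of variables\<close>

definition hodograph_shift :: "(real \<Rightarrow> complex) \<Rightarrow> (real \<Rightarrow> real) \<Rightarrow> bool" where
  "hodograph_shift qH \<epsilon> \<longleftrightarrow>
     mono \<epsilon> \<and> bounded (range \<epsilon>) \<and> continuous_on UNIV \<epsilon> \<and> (\<epsilon> \<longlongrightarrow> 0) at_bot \<and>
     (\<forall>x. set_integrable lebesgue {..x} (\<lambda>y. sqrt (1 + (cmod (qH (y + \<epsilon> y)))\<^sup>2) - 1) \<and>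
          \<epsilon> x = (LINT y:{..x}|lebesgue. sqrt (1 + (cmod (qH (y + \<epsilon> y)))\<^sup>2) - 1))"

end

theory Submission
  imports Defs "HOL-Probability.Sinc_Integral"
begin

text \<open>
The claim is one about function spaces: if \<open>q\<close> is in \<^term>\<open>X_space m\<close> and \<open>\<epsilon>\<close> solves the integral
equation of the hodograph shift for \<open>q\<close>, then \<open>q \<circ> \<Phi>\<close> is in \<^term>\<open>X_space m\<close>, where \<open>\<Phi> x = x + \<epsilon> x\<close>
(\<open>X_space_hodograph\<close> below).  It is applied at each fixed time, to the function that the
Riemann-Hilbert problem produces at that time.

Why composition with \<open>\<Phi>\<close> preserves the space: as \<open>m \<ge> 1\<close>, the function \<open>q\<close> agrees almost
everywhere with a continuous \<open>u\<close>.  The shift \<open>\<epsilon>\<close> is increasing, so \<open>\<Phi>\<close> expands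
distances and preimages of null sets under \<open>\<Phi>\<close> are null.  Hence \<open>q\<close> may be replaced by \<open>u\<close> inside
the integral equation, which then shows that \<open>\<Phi>\<close> is continuously differentiable and solves the
autonomous equation \<open>\<Phi>' = s \<circ> \<Phi>\<close> with \<open>s = sqrt (1 + |u|\<^sup>2) \<ge> 1\<close>.  For every \<open>v\<close> one therefore has
\<open>(v \<circ> \<Phi>)' = (s v') \<circ> \<Phi>\<close>: differentiating \<open>v \<circ> \<Phi>\<close> amounts to applying the operator \<open>v \<mapsto> s v'\<close> before
composing.  By induction on the order, all that is needed is that multiplication by \<open>s\<close> preserves
the spaces of lower order, and that composition with \<open>\<Phi>\<close> preserves weighted square integrability.
The latter is a change of variables: \<open>\<Phi>' \<ge> 1\<close> controls the Jacobian, and the boundedness of \<open>\<epsilon>\<close> makes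
the weights at \<open>x\<close> and \<open>\<Phi> x\<close> comparable.

The highest derivative is only square integrable, so products and compositions must be
differentiated in the almost everywhere sense.  The calculus used is that of locally absolutely
continuous functions, encoded by \<open>ac_derivative u g\<close>: \<open>u\<close> is an indefinite Lebesgue integral of \<open>g\<close>.
Its chain rule \<open>ac_derivative_compose\<close> is obtained by approximating \<open>g\<close> in mean by continuous
functions.  The recursively defined spaces \<open>X_ac k\<close> collect the functions with \<open>k\<close> successive such
derivatives, all of them weighted square integrable.  They form the same spaces as \<open>X_space k\<close> up
to null sets; one direction is integration by parts against test functions, the other is the
lemma of du Bois-Reymond (\<open>du_Bois_Reymond\<close>), which turns weak derivatives into primitives.
\<close>

section \<open>Locally absolutely continuous functions\<close>

text \<open>The fundamental theorem of calculus is taken as the definition, since every use of absolute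
  continuity below goes through it; \<open>g\<close> matters only up to null sets.\<close>

definition ac_derivative :: "(real \<Rightarrow> 'a::euclidean_space) \<Rightarrow> (real \<Rightarrow> 'a) \<Rightarrow> bool" where
  "ac_derivative u g \<longleftrightarrow> (\<forall>a b. a \<le> b \<longrightarrow>
     g absolutely_integrable_on {a..b} \<and> (g has_integral (u b - u a)) {a..b})"

text \<open>Truncating \<open>g\<close> radially at a large height changes it little in mean.  A bounded measurable
  function is an almost everywhere limit of continuous functions, and truncating these at the
  same height provides the dominating constant.\<close>

lemma continuous_L1_approximation:
  fixes g :: "real \<Rightarrow> 'a::euclidean_space"
  assumes g: "g absolutely_integrable_on {a..b}" and e: "e > 0"
  obtains c where "continuous_on UNIV c" "integral {a..b} (\<lambda>x. norm (c x - g x)) < e"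
proof -
  \<comment> \<open>the radial retraction onto the ball of radius \<open>N\<close>\<close>
  define P :: "real \<Rightarrow> 'a \<Rightarrow> 'a" where "P N z = (N / max N (norm z)) *\<^sub>R z" for N z
  have P_le: "norm (P N z) \<le> norm z" if "N > 0" for N z
  proof -
    have r: "N / max N (norm z) \<le> 1" "0 \<le> N / max N (norm z)"
      using that by (auto simp: divide_le_eq_1)
    then have "norm (P N z) = N / max N (norm z) * norm z"
      by (simp only: P_def norm_scaleR real_norm_def abs_of_nonneg)
    then show ?thesis
      using mult_right_mono[OF r(1), of "norm z"] by simp
  qed
  have P_bound: "norm (P N z) \<le> N" if "N > 0" for N z
    using that by (auto simp: P_def max_def divide_simps)
  have P_id: "P N z = z" if "norm z \<le> N" "N > 0" for N z
    using that by (simp add: P_def max_def)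
  have P_cont: "continuous_on UNIV (P N)" if "N > 0" for N
    unfolding P_def using that by (intro continuous_intros) (auto simp: max_def)
  have S: "{a..b} \<in> sets lebesgue" by simp
  have g_meas: "g \<in> borel_measurable (lebesgue_on {a..b})"
    using absolutely_integrable_imp_borel_measurable[OF g] by simp
  have ng: "(\<lambda>x. norm (g x)) integrable_on {a..b}"
    using g by (auto simp: absolutely_integrable_on_def)
  have Pg_meas: "(\<lambda>x. P N (g x)) \<in> borel_measurable (lebesgue_on {a..b})" if "N > 0" for N
    by (rule borel_measurable_continuous_on[OF P_cont[OF that] g_meas])
  have Pg: "(\<lambda>x. P N (g x)) absolutely_integrable_on {a..b}" if "N > 0" for N
    by (rule measurable_bounded_by_integrable_imp_absolutely_integrable[OF Pg_meas[OF that] S ng])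
       (use P_le that in auto)
  have "(\<lambda>n. integral {a..b} (\<lambda>x. norm (P (real (Suc n)) (g x) - g x))) \<longlonglongrightarrow> integral {a..b} (\<lambda>x. 0::real)"
  proof (rule dominated_convergence(2))
    show "(\<lambda>x. norm (P (real (Suc n)) (g x) - g x)) integrable_on {a..b}" for n
      using set_integral_diff(1)[OF Pg[of "real (Suc n)"] g] by (auto simp: absolutely_integrable_on_def)
    show "(\<lambda>x. 2 * norm (g x)) integrable_on {a..b}"
      using ng by (intro integrable_on_mult_right)
    show "norm (norm (P (real (Suc n)) (g x) - g x)) \<le> 2 * norm (g x)" for n x
      using norm_triangle_ineq4[of "P (real (Suc n)) (g x)" "g x"] P_le[of "real (Suc n)" "g x"] by simp
    show "(\<lambda>n. norm (P (real (Suc n)) (g x) - g x)) \<longlonglongrightarrow> 0" for x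
    proof (rule tendsto_eventually)
      obtain n0 where "norm (g x) \<le> real n0" using real_arch_simple by blast
      then show "\<forall>\<^sub>F n in sequentially. norm (P (real (Suc n)) (g x) - g x) = 0"
        by (intro eventually_sequentiallyI[of n0]) (auto intro!: P_id)
    qed
  qed
  then have "(\<lambda>n. integral {a..b} (\<lambda>x. norm (P (real (Suc n)) (g x) - g x))) \<longlonglongrightarrow> 0" by simp
  from order_tendstoD(2)[OF this, of "e/2"] e obtain n where
    n: "integral {a..b} (\<lambda>x. norm (P (real (Suc n)) (g x) - g x)) < e/2"
    by (auto simp only: eventually_sequentially half_gt_zero_iff)
  define N where "N = real (Suc n)"
  have N: "N > 0" by (simp add: N_def)
  define h where "h x = P N (g x)" for x
  have h_le: "norm (h x) \<le> N" for x using P_bound[OF N] by (simp add: h_def)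
  have h_ai: "h absolutely_integrable_on {a..b}" using Pg[OF N] by (simp add: h_def[abs_def])
  have "h measurable_on {a..b}"
    unfolding measurable_on_iff_borel_measurable[OF S] h_def using Pg_meas[OF N] .
  then obtain Z \<gamma> where Z: "negligible Z" and \<gamma>: "\<And>n. continuous_on UNIV (\<gamma> n)"
    and lim: "\<And>x. x \<notin> Z \<Longrightarrow> (\<lambda>n. \<gamma> n x) \<longlonglongrightarrow> (if x \<in> {a..b} then h x else 0)"
    unfolding measurable_on_def by blast
  have c_cont: "continuous_on UNIV (\<lambda>x. P N (\<gamma> n x))" for n
    using continuous_on_compose2[OF P_cont[OF N] \<gamma>] by simp
  have c_ai: "(\<lambda>x. P N (\<gamma> n x)) absolutely_integrable_on {a..b}" for n
    using c_cont continuous_on_subset by (intro absolutely_integrable_continuous_real) blast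
  define d where "d n x = (if x \<in> Z then 0 else norm (P N (\<gamma> n x) - h x))" for n x
  have d_int: "(\<lambda>x. norm (P N (\<gamma> n x) - h x)) integrable_on {a..b}" for n
    using set_integral_diff(1)[OF c_ai h_ai] by (auto simp: absolutely_integrable_on_def)
  have d_eq: "integral {a..b} (d n) = integral {a..b} (\<lambda>x. norm (P N (\<gamma> n x) - h x))" for n
    by (rule integral_spike[OF Z]) (simp add: d_def)
  have "(\<lambda>n. integral {a..b} (d n)) \<longlonglongrightarrow> integral {a..b} (\<lambda>x. 0::real)"
  proof (rule dominated_convergence(2))
    show "d n integrable_on {a..b}" for n
      by (rule integrable_spike[OF d_int[of n] Z]) (simp add: d_def)
    show "(\<lambda>x. 2 * N) integrable_on {a..b}" by (rule integrable_const_ivl)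
    show "norm (d n x) \<le> 2 * N" for n x
      using norm_triangle_ineq4[of "P N (\<gamma> n x)" "h x"] P_bound[OF N, of "\<gamma> n x"] h_le[of x] N
      by (simp add: d_def)
    show "(\<lambda>n. d n x) \<longlonglongrightarrow> 0" if x: "x \<in> {a..b}" for x
    proof (cases "x \<in> Z")
      case False
      have "isCont (P N) (h x)" using P_cont[OF N] by (simp add: continuous_on_eq_continuous_at)
      then have "(\<lambda>n. P N (\<gamma> n x)) \<longlonglongrightarrow> P N (h x)"
        using lim[OF False] x isCont_tendsto_compose by force
      then have "(\<lambda>n. norm (P N (\<gamma> n x) - h x)) \<longlonglongrightarrow> 0"
        using P_id[OF h_le N] by (simp add: LIM_zero tendsto_norm_zero)
      with False show ?thesis by (simp add: d_def)
    qed (simp add: d_def)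
  qed
  then have "(\<lambda>n. integral {a..b} (d n)) \<longlonglongrightarrow> 0" by simp
  from order_tendstoD(2)[OF this, of "e/2"] e obtain k where k: "integral {a..b} (d k) < e/2"
    by (auto simp only: eventually_sequentially half_gt_zero_iff)
  have int: "(\<lambda>x. norm (P N (\<gamma> k x) - g x)) integrable_on {a..b}"
    using set_integral_diff(1)[OF c_ai g] by (auto simp: absolutely_integrable_on_def)
  have int': "(\<lambda>x. norm (h x - g x)) integrable_on {a..b}"
    using set_integral_diff(1)[OF h_ai g] by (auto simp: absolutely_integrable_on_def)
  have "integral {a..b} (\<lambda>x. norm (P N (\<gamma> k x) - g x))
      \<le> integral {a..b} (\<lambda>x. norm (P N (\<gamma> k x) - h x) + norm (h x - g x))"
    using int int' d_int[of k] norm_triangle_ineq[of "P N (\<gamma> k x) - h x" "h x - g x" for x]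
    by (intro integral_le integrable_add) auto
  also have "\<dots> = integral {a..b} (d k) + integral {a..b} (\<lambda>x. norm (h x - g x))"
    using int' d_int[of k] by (simp add: integral_add d_eq)
  also have "\<dots> < e"
    using k n by (simp add: h_def N_def)
  finally show ?thesis using that c_cont by blast
qed

text \<open>Expanding \<open>g x\<close> in the basis reduces the claim to products of integrable scalar functions
  with bounded continuous vectors; this avoids integration in the space of linear maps.\<close>

lemma absolutely_integrable_blinfun_apply:
  fixes g :: "real \<Rightarrow> 'a::euclidean_space" and A :: "real \<Rightarrow> 'a \<Rightarrow>\<^sub>L 'b::euclidean_space"
  assumes g: "g absolutely_integrable_on {a..b}" and A: "continuous_on {a..b} A"
  shows "(\<lambda>x. A x (g x)) absolutely_integrable_on {a..b}"
proof -
  have "(\<lambda>x. (g x \<bullet> i) *\<^sub>R A x i) absolutely_integrable_on {a..b}" if "i \<in> Basis" for i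
  proof -
    have ci: "continuous_on {a..b} (\<lambda>x. A x i)" using A by (intro continuous_intros)
    have gi: "(\<lambda>x. g x \<bullet> i) absolutely_integrable_on {a..b}"
      using absolutely_integrable_component[OF g] by simp
    show ?thesis
    proof (rule absolutely_integrable_bounded_measurable_product
        [of "\<lambda>v r. r *\<^sub>R v" "\<lambda>x. A x i" "{a..b}" "\<lambda>x. g x \<bullet> i", OF _ _ _ _ gi])
      show "bilinear (\<lambda>(v::'b) (r::real). r *\<^sub>R v)"
        by (simp add: bilinear_def linear_iff algebra_simps)
      show "(\<lambda>x. A x i) \<in> borel_measurable (lebesgue_on {a..b})"
        by (rule continuous_imp_measurable_on_sets_lebesgue[OF ci]) simp
      show "bounded ((\<lambda>x. A x i) ` {a..b})"
        by (intro compact_imp_bounded compact_continuous_image[OF ci]) simp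
    qed simp
  qed
  then have "(\<lambda>x. \<Sum>i\<in>Basis. (g x \<bullet> i) *\<^sub>R A x i) absolutely_integrable_on {a..b}"
    by (intro absolutely_integrable_sum) auto
  moreover have "A x (g x) = (\<Sum>i\<in>Basis. (g x \<bullet> i) *\<^sub>R A x i)" for x
    by (subst (1) euclidean_representation[symmetric, of "g x"])
       (simp only: blinfun.sum_right blinfun.scaleR_right)
  ultimately show ?thesis by simp
qed

lemma ac_derivative_eq:
  assumes "ac_derivative u g" "a \<le> x"
  shows "u x = u a + integral {a..x} g"
proof -
  have "(g has_integral (u x - u a)) {a..x}"
    using assms by (auto simp: ac_derivative_def)
  from integral_unique[OF this] show ?thesis by simp
qed

lemma ac_derivative_continuous:
  assumes "ac_derivative u g"
  shows "continuous_on UNIV u"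
proof -
  have "isCont u x" for x
  proof -
    have g: "g integrable_on {x-1..x+1}"
      using assms by (auto simp: ac_derivative_def absolutely_integrable_on_def)
    have "continuous_on {x-1..x+1} (\<lambda>y. u (x-1) + integral {x-1..y} g)"
      by (intro continuous_intros indefinite_integral_continuous_1 g)
    moreover have "u (x-1) + integral {x-1..y} g = u y" if "y \<in> {x-1..x+1}" for y
      using ac_derivative_eq[OF assms, of "x-1" y] that by simp
    ultimately have "continuous_on {x-1..x+1} u" by (rule continuous_on_eq)
    then show ?thesis
      by (rule continuous_on_interior) simp
  qed
  then show ?thesis by (simp add: continuous_on_eq_continuous_at)
qed

text \<open>If the derivative of \<open>u\<close> is continuous, this is the classical chain rule together
  with the fundamental theorem of calculus.  In general, \<open>g\<close> is replaced by continuous functions \<open>c n\<close>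
  that converge to it in mean; their primitives \<open>U n\<close> converge to \<open>u\<close> uniformly and stay in a fixed
  ball, on which the derivative of \<open>H\<close> is bounded, so both sides of the identity pass to the limit.\<close>

lemma ac_derivative_compose:
  fixes u :: "real \<Rightarrow> 'a::euclidean_space" and H :: "'a \<Rightarrow> 'b::euclidean_space"
    and H' :: "'a \<Rightarrow> 'a \<Rightarrow>\<^sub>L 'b"
  assumes u: "ac_derivative u g"
    and H: "\<And>z. (H has_derivative blinfun_apply (H' z)) (at z)"
    and H': "continuous_on UNIV H'"
  shows "ac_derivative (\<lambda>x. H (u x)) (\<lambda>x. H' (u x) (g x))"
  unfolding ac_derivative_def
proof (intro allI impI)
  fix a b :: real assume ab: "a \<le> b"
  have g: "g absolutely_integrable_on {a..b}" and g_int: "g integrable_on {a..b}"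
    using u ab by (auto simp: ac_derivative_def absolutely_integrable_on_def)
  have ng: "(\<lambda>x. norm (g x)) integrable_on {a..b}"
    using g by (auto simp: absolutely_integrable_on_def)
  have u_eq: "u x = u a + integral {a..x} g" if "x \<in> {a..b}" for x
    using ac_derivative_eq[OF u, of a x] that by simp
  have u_cont: "continuous_on {a..b} u"
    using ac_derivative_continuous[OF u] continuous_on_subset by blast
  have H_cont: "isCont H z" for z using H has_derivative_continuous by blast
  have "\<exists>c. continuous_on UNIV c \<and> integral {a..b} (\<lambda>x. norm (c x - g x)) < inverse (real (Suc n))" for n
    using continuous_L1_approximation[OF g, of "inverse (real (Suc n))"] by (metis inverse_positive_iff_positive of_nat_0_less_iff zero_less_Suc)
  then obtain c where c: "\<And>n. continuous_on UNIV (c n)"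
    and c_close: "\<And>n. integral {a..b} (\<lambda>x. norm (c n x - g x)) < inverse (real (Suc n))" by metis
  have c_cont: "continuous_on {a..b} (c n)" for n using c continuous_on_subset by blast
  have c_ai: "c n absolutely_integrable_on {a..b}" for n
    by (rule absolutely_integrable_continuous_real[OF c_cont])
  have diff_ai: "(\<lambda>x. c n x - g x) absolutely_integrable_on {a..b}" for n
    by (rule set_integral_diff(1)[OF c_ai g])
  then have diff_int: "(\<lambda>x. c n x - g x) integrable_on {a..b}"
      "(\<lambda>x. norm (c n x - g x)) integrable_on {a..b}" for n
    by (auto simp: absolutely_integrable_on_def)
  define U where "U n x = u a + integral {a..x} (c n)" for n x
  have U_deriv: "(U n has_vector_derivative c n x) (at x within {a..b})" if "x \<in> {a..b}" for n x
    unfolding U_def using integral_has_vector_derivative[OF c_cont that]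
    by (auto intro!: derivative_eq_intros)
  have U_cont: "continuous_on {a..b} (U n)" for n
    unfolding continuous_on_eq_continuous_within
    using has_vector_derivative_continuous[OF U_deriv] by blast
  have close: "norm (U n x - u x) \<le> inverse (real (Suc n))" if x: "x \<in> {a..b}" for n x
  proof -
    have sub: "{a..x} \<subseteq> {a..b}" using x by auto
    have "U n x - u x = integral {a..x} (\<lambda>y. c n y - g y)"
      using integrable_on_subinterval[OF g_int sub] integrable_on_subinterval[OF integrable_continuous_real[OF c_cont] sub]
      by (simp add: U_def u_eq[OF x] integral_diff)
    also have "norm \<dots> \<le> integral {a..x} (\<lambda>y. norm (c n y - g y))"
      using integrable_on_subinterval[OF diff_int(1) sub] integrable_on_subinterval[OF diff_int(2) sub]
      by (intro integral_norm_bound_integral) auto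
    also have "\<dots> \<le> integral {a..b} (\<lambda>y. norm (c n y - g y))"
      using integrable_on_subinterval[OF diff_int(2) sub] diff_int(2) sub
      by (intro integral_subset_le) auto
    finally show ?thesis using c_close[of n] by simp
  qed
  have U_lim: "(\<lambda>n. U n x) \<longlonglongrightarrow> u x" if x: "x \<in> {a..b}" for x
  proof (rule LIM_zero_cancel, rule tendsto_0_le[OF LIMSEQ_inverse_real_of_nat, of _ 1])
    show "\<forall>\<^sub>F n in sequentially. norm (U n x - u x) \<le> norm (inverse (real (Suc n))) * 1"
      using close[OF x] by simp
  qed
  have "bounded (u ` {a..b})" by (intro compact_imp_bounded compact_continuous_image[OF u_cont]) simp
  then obtain R where R: "\<And>x. x \<in> {a..b} \<Longrightarrow> norm (u x) \<le> R"
    unfolding bounded_iff by (metis image_eqI)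
  have U_R: "norm (U n x) \<le> R + 1" if x: "x \<in> {a..b}" for n x
  proof -
    have "norm (U n x) \<le> norm (u x) + norm (U n x - u x)" by (rule norm_triangle_sub)
    also have "inverse (real (Suc n)) \<le> 1" by (simp add: inverse_le_1_iff)
    then have "norm (u x) + norm (U n x - u x) \<le> R + 1" using R[OF x] close[OF x, of n] by linarith
    finally show ?thesis .
  qed
  have "bounded (H' ` cball 0 (R+1))"
    by (intro compact_imp_bounded compact_continuous_image continuous_on_subset[OF H']) auto
  then obtain C where "C > 0" and C: "\<And>A. A \<in> H' ` cball 0 (R+1) \<Longrightarrow> norm A \<le> C"
    unfolding bounded_pos by blast
  have C0: "C \<ge> 0" using \<open>C > 0\<close> by simp
  have C: "norm (H' z) \<le> C" if "norm z \<le> R+1" for z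
    using that C by auto
  have HU_cont: "continuous_on {a..b} (\<lambda>x. H' (U n x))" for n
    by (rule continuous_on_compose2[OF H' U_cont]) auto
  have Hu_ai: "(\<lambda>x. H' (u x) (g x)) absolutely_integrable_on {a..b}"
    by (rule absolutely_integrable_blinfun_apply[OF g]) (rule continuous_on_compose2[OF H' u_cont], auto)
  have I: "((\<lambda>x. H' (U n x) (c n x)) has_integral (H (U n b) - H (U n a))) {a..b}" for n
  proof (rule fundamental_theorem_of_calculus[OF ab])
    fix x assume x: "x \<in> {a..b}"
    have "((\<lambda>y. H (U n y)) has_derivative (\<lambda>t. H' (U n x) (t *\<^sub>R c n x))) (at x within {a..b})"
      using has_derivative_compose[OF U_deriv[OF x, of n, unfolded has_vector_derivative_def] H] .
    then show "((\<lambda>y. H (U n y)) has_vector_derivative H' (U n x) (c n x)) (at x within {a..b})"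
      by (simp add: has_vector_derivative_def blinfun.scaleR_right)
  qed
  \<comment> \<open>\<open>J n\<close> replaces \<open>c n\<close> by \<open>g\<close> but keeps \<open>U n\<close>: one error is controlled by the mean distance of
    \<open>c n\<close> and \<open>g\<close>, the other by dominated convergence\<close>
  define J where "J n = integral {a..b} (\<lambda>x. H' (U n x) (g x))" for n
  have HUg: "(\<lambda>x. H' (U n x) (g x)) integrable_on {a..b}" for n
    using absolutely_integrable_blinfun_apply[OF g HU_cont] by (auto simp: absolutely_integrable_on_def)
  have bnd: "norm (H' (U n x) v) \<le> C * norm v" if "x \<in> {a..b}" for n x v
    using order_trans[OF norm_blinfun mult_right_mono[OF C[OF U_R[OF that]] norm_ge_zero]] .
  have J: "J \<longlonglongrightarrow> integral {a..b} (\<lambda>x. H' (u x) (g x))"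
    unfolding J_def
  proof (rule dominated_convergence(2)[where h = "\<lambda>x. C * norm (g x)"])
    show "(\<lambda>x. C * norm (g x)) integrable_on {a..b}" using ng by (rule integrable_on_mult_right)
    show "(\<lambda>n. H' (U n x) (g x)) \<longlonglongrightarrow> H' (u x) (g x)" if x: "x \<in> {a..b}" for x
    proof -
      have "isCont H' (u x)" using H' by (simp add: continuous_on_eq_continuous_at)
      from isCont_tendsto_compose[OF this U_lim[OF x]] show ?thesis by (intro tendsto_intros)
    qed
  qed (use HUg bnd in auto)
  have IJ: "norm ((H (U n b) - H (U n a)) - J n) \<le> C * inverse (real (Suc n))" for n
  proof -
    have d: "(\<lambda>x. H' (U n x) (c n x - g x)) integrable_on {a..b}"
      using absolutely_integrable_blinfun_apply[OF diff_ai HU_cont] by (auto simp: absolutely_integrable_on_def)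
    have "(H (U n b) - H (U n a)) - J n = integral {a..b} (\<lambda>x. H' (U n x) (c n x - g x))"
      using integral_diff[OF has_integral_integrable[OF I[of n]] HUg[of n]] integral_unique[OF I[of n]]
      by (simp add: J_def blinfun.diff_right)
    also have "norm \<dots> \<le> integral {a..b} (\<lambda>x. C * norm (c n x - g x))"
      using d diff_int(2)[of n] bnd by (intro integral_norm_bound_integral integrable_on_mult_right) auto
    also have "\<dots> \<le> C * inverse (real (Suc n))"
      using c_close[of n] C0 by (simp add: mult_left_mono)
    finally show ?thesis .
  qed
  have "(\<lambda>n. (H (U n b) - H (U n a)) - J n) \<longlonglongrightarrow> 0"
    by (rule tendsto_0_le[OF LIMSEQ_inverse_real_of_nat, of _ C]) (use IJ in \<open>simp add: mult.commute\<close>)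
  moreover have "(\<lambda>n. (H (U n b) - H (U n a)) - J n) \<longlonglongrightarrow>
      (H (u b) - H (u a)) - integral {a..b} (\<lambda>x. H' (u x) (g x))"
    using ab by (intro tendsto_diff J isCont_tendsto_compose[OF H_cont] U_lim) auto
  ultimately have "integral {a..b} (\<lambda>x. H' (u x) (g x)) = H (u b) - H (u a)"
    using LIMSEQ_unique by fastforce
  then show "(\<lambda>x. H' (u x) (g x)) absolutely_integrable_on {a..b} \<and>
      ((\<lambda>x. H' (u x) (g x)) has_integral (H (u b) - H (u a))) {a..b}"
    using Hu_ai by (auto simp: absolutely_integrable_on_def has_integral_iff)
qed

lemma ac_derivative_bounded_linear:
  fixes L :: "'a::euclidean_space \<Rightarrow> 'b::euclidean_space"
  assumes "bounded_linear L" "ac_derivative u g"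
  shows "ac_derivative (\<lambda>x. L (u x)) (\<lambda>x. L (g x))"
  unfolding ac_derivative_def
proof (intro allI impI conjI)
  fix a b :: real assume "a \<le> b"
  then have "g absolutely_integrable_on {a..b}" and g: "(g has_integral (u b - u a)) {a..b}"
    using assms(2) by (auto simp: ac_derivative_def)
  then show "(\<lambda>x. L (g x)) absolutely_integrable_on {a..b}"
    using absolutely_integrable_linear[OF _ assms(1)] by (simp add: o_def)
  show "((\<lambda>x. L (g x)) has_integral (L (u b) - L (u a))) {a..b}"
    using has_integral_linear[OF g assms(1)] by (simp add: o_def linear_diff bounded_linear.linear assms(1))
qed

lemma ac_derivative_add:
  assumes "ac_derivative u g" "ac_derivative v h"
  shows "ac_derivative (\<lambda>x. u x + v x) (\<lambda>x. g x + h x)"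
  unfolding ac_derivative_def
proof (intro allI impI conjI)
  fix a b :: real assume ab: "a \<le> b"
  show "(\<lambda>x. g x + h x) absolutely_integrable_on {a..b}"
    using assms ab by (intro set_integral_add(1)) (auto simp: ac_derivative_def)
  have "((\<lambda>x. g x + h x) has_integral (u b - u a) + (v b - v a)) {a..b}"
    using assms ab by (intro has_integral_add) (auto simp: ac_derivative_def)
  then show "((\<lambda>x. g x + h x) has_integral (u b + v b - (u a + v a))) {a..b}"
    by (simp add: algebra_simps)
qed

text \<open>The chain rule for the multiplication of complex numbers, applied to the pair of both functions.\<close>

lemma ac_derivative_mult:
  fixes u v :: "real \<Rightarrow> complex"
  assumes "ac_derivative u g" "ac_derivative v h"
  shows "ac_derivative (\<lambda>x. u x * v x) (\<lambda>x. u x * h x + g x * v x)"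
proof -
  have pair: "ac_derivative (\<lambda>x. (u x, v x)) (\<lambda>x. (g x, h x))"
    using ac_derivative_add[OF
        ac_derivative_bounded_linear[OF bounded_linear_Pair[OF bounded_linear_ident bounded_linear_zero] assms(1)]
        ac_derivative_bounded_linear[OF bounded_linear_Pair[OF bounded_linear_zero bounded_linear_ident] assms(2)]]
    by simp
  define H' :: "complex \<times> complex \<Rightarrow> (complex \<times> complex) \<Rightarrow>\<^sub>L complex"
    where "H' z = Blinfun (\<lambda>w. fst z * snd w + fst w * snd z)" for z
  have app: "blinfun_apply (H' z) = (\<lambda>w. fst z * snd w + fst w * snd z)" for z
    unfolding H'_def by (rule bounded_linear_Blinfun_apply) (intro bounded_linear_intros)
  have cont: "continuous_on UNIV H'"
    by (rule continuous_on_blinfun_componentwise) (simp add: app, intro continuous_intros)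
  have "((\<lambda>z. fst z * snd z) has_derivative blinfun_apply (H' z)) (at z)" for z :: "complex \<times> complex"
    unfolding app by (auto intro!: derivative_eq_intros)
  from ac_derivative_compose[OF pair this cont] show ?thesis by (simp add: app)
qed

section \<open>Weighted square integrability\<close>

definition weighted_L2 :: "(real \<Rightarrow> complex) set" where
  "weighted_L2 = {g. (\<lambda>x. of_real (sqrt (1 + x\<^sup>2)) * g x) \<in> L2}"

lemma weighted_L2_iff:
  "g \<in> weighted_L2 \<longleftrightarrow>
     g \<in> borel_measurable lebesgue \<and> integrable lebesgue (\<lambda>x. (1 + x\<^sup>2) * (cmod (g x))\<^sup>2)"
proof -
  let ?w = "\<lambda>x::real. of_real (sqrt (1 + x\<^sup>2)) :: complex"
  have w_meas: "?w \<in> borel_measurable lebesgue" "(\<lambda>x. 1 / ?w x) \<in> borel_measurable lebesgue"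
    by (rule measurable_completion, measurable)+
  have w_pos: "1 + x\<^sup>2 > 0" for x :: real
    by (simp add: add_pos_nonneg)
  have "(\<lambda>x. ?w x * g x) \<in> borel_measurable lebesgue \<longleftrightarrow> g \<in> borel_measurable lebesgue"
  proof
    assume "(\<lambda>x. ?w x * g x) \<in> borel_measurable lebesgue"
    from borel_measurable_times[OF w_meas(2) this]
    show "g \<in> borel_measurable lebesgue" using w_pos by (simp add: less_imp_neq[symmetric])
  qed (use w_meas in measurable)
  moreover have "(cmod (?w x * g x))\<^sup>2 = (1 + x\<^sup>2) * (cmod (g x))\<^sup>2" for x
    using w_pos[of x] by (simp add: norm_mult power_mult_distrib)
  ultimately show ?thesis by (simp add: weighted_L2_def L2_def)
qed

lemma weighted_L2_dominated:
  assumes g: "g \<in> borel_measurable lebesgue"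
    and h: "integrable lebesgue (\<lambda>x. (1 + x\<^sup>2) * h x)"
    and le: "AE x in lebesgue. (cmod (g x))\<^sup>2 \<le> h x"
  shows "g \<in> weighted_L2"
  unfolding weighted_L2_iff
proof (intro conjI g Bochner_Integration.integrable_bound[OF h])
  have "(\<lambda>x::real. 1 + x\<^sup>2) \<in> borel_measurable lebesgue"
    by (rule measurable_completion) measurable
  then show "(\<lambda>x. (1 + x\<^sup>2) * (cmod (g x))\<^sup>2) \<in> borel_measurable lebesgue"
    using g by measurable
  show "AE x in lebesgue. norm ((1 + x\<^sup>2) * (cmod (g x))\<^sup>2) \<le> norm ((1 + x\<^sup>2) * h x)"
    using le
  proof eventually_elim
    case (elim x)
    then have "0 \<le> h x" using zero_le_power2[of "cmod (g x)"] by linarith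
    then show ?case using elim by (simp add: abs_mult mult_left_mono)
  qed
qed

lemma weighted_L2_AE_cong:
  assumes "g \<in> weighted_L2" "AE x in lebesgue. g x = h x"
  shows "h \<in> weighted_L2"
proof (rule weighted_L2_dominated)
  show "h \<in> borel_measurable lebesgue"
    using assms borel_measurable_AE[of g h] by (simp add: weighted_L2_iff)
  show "integrable lebesgue (\<lambda>x. (1 + x\<^sup>2) * (cmod (g x))\<^sup>2)"
    using assms by (simp add: weighted_L2_iff)
  show "AE x in lebesgue. (cmod (h x))\<^sup>2 \<le> (cmod (g x))\<^sup>2"
    using assms(2) by eventually_elim simp
qed

lemma weighted_L2_bounded_mult:
  assumes g: "g \<in> weighted_L2" and s: "s \<in> borel_measurable lebesgue" "\<And>x. cmod (s x) \<le> C"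
  shows "(\<lambda>x. s x * g x) \<in> weighted_L2"
proof (rule weighted_L2_dominated)
  show "(\<lambda>x. s x * g x) \<in> borel_measurable lebesgue"
    using g s by (auto simp: weighted_L2_iff)
  have "integrable lebesgue (\<lambda>x. C\<^sup>2 * ((1 + x\<^sup>2) * (cmod (g x))\<^sup>2))"
    using g by (auto simp: weighted_L2_iff)
  then show "integrable lebesgue (\<lambda>x. (1 + x\<^sup>2) * (C\<^sup>2 * (cmod (g x))\<^sup>2))"
    by (simp add: mult_ac)
  show "AE x in lebesgue. (cmod (s x * g x))\<^sup>2 \<le> C\<^sup>2 * (cmod (g x))\<^sup>2"
    using s(2) by (auto simp: norm_mult power_mult_distrib intro!: AE_I2 mult_right_mono power_mono)
qed

lemma weighted_L2_add:
  assumes "g \<in> weighted_L2" "h \<in> weighted_L2"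
  shows "(\<lambda>x. g x + h x) \<in> weighted_L2"
proof (rule weighted_L2_dominated)
  show "(\<lambda>x. g x + h x) \<in> borel_measurable lebesgue"
    using assms by (auto simp: weighted_L2_iff)
  have "integrable lebesgue (\<lambda>x. 2 * ((1 + x\<^sup>2) * (cmod (g x))\<^sup>2) + 2 * ((1 + x\<^sup>2) * (cmod (h x))\<^sup>2))"
    using assms by (intro Bochner_Integration.integrable_add integrable_mult_right) (auto simp: weighted_L2_iff)
  then show "integrable lebesgue (\<lambda>x. (1 + x\<^sup>2) * (2 * (cmod (g x))\<^sup>2 + 2 * (cmod (h x))\<^sup>2))"
    by (simp add: algebra_simps)
  have "(cmod (g x + h x))\<^sup>2 \<le> 2 * (cmod (g x))\<^sup>2 + 2 * (cmod (h x))\<^sup>2" for x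
  proof -
    have "(cmod (g x + h x))\<^sup>2 \<le> (cmod (g x) + cmod (h x))\<^sup>2"
      by (intro power_mono norm_triangle_ineq) simp
    also have "\<dots> \<le> 2 * (cmod (g x))\<^sup>2 + 2 * (cmod (h x))\<^sup>2"
      using zero_le_power2[of "cmod (g x) - cmod (h x)"] by (simp add: power2_eq_square algebra_simps)
    finally show ?thesis .
  qed
  then show "AE x in lebesgue. (cmod (g x + h x))\<^sup>2 \<le> 2 * (cmod (g x))\<^sup>2 + 2 * (cmod (h x))\<^sup>2"
    by simp
qed

lemma weighted_L2_cnj: "g \<in> weighted_L2 \<Longrightarrow> (\<lambda>x. cnj (g x)) \<in> weighted_L2"
  using borel_measurable_continuous_on[of cnj g lebesgue]
  by (simp add: weighted_L2_iff continuous_on_cnj)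

lemma weighted_L2_imp_L2:
  assumes "g \<in> weighted_L2"
  shows "g \<in> L2"
proof -
  have "integrable lebesgue (\<lambda>x. (cmod (g x))\<^sup>2)"
  proof (rule Bochner_Integration.integrable_bound)
    show "integrable lebesgue (\<lambda>x. (1 + x\<^sup>2) * (cmod (g x))\<^sup>2)"
      using assms by (simp add: weighted_L2_iff)
    show "AE x in lebesgue. norm ((cmod (g x))\<^sup>2) \<le> norm ((1 + x\<^sup>2) * (cmod (g x))\<^sup>2)"
      by (simp add: distrib_right)
  qed (use assms in \<open>auto simp: weighted_L2_iff\<close>)
  then show ?thesis using assms by (simp add: L2_def weighted_L2_iff)
qed

text \<open>The weight is what makes these functions integrable on the whole line: \<open>|g|\<close> is at most
  \<open>1 / w\<^sup>2 + w\<^sup>2 |g|\<^sup>2\<close> where \<open>w\<^sup>2 = 1 + x\<^sup>2\<close>.\<close>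

lemma weighted_L2_integrable:
  assumes "g \<in> weighted_L2"
  shows "integrable lebesgue g"
proof (rule Bochner_Integration.integrable_bound)
  have "integrable lborel (\<lambda>x::real. inverse (1 + x\<^sup>2))"
    using integrable_inverse_1_plus_square by (simp add: set_integrable_def)
  then have "integrable lebesgue (\<lambda>x::real. inverse (1 + x\<^sup>2))"
    by (simp add: integrable_completion)
  then show "integrable lebesgue (\<lambda>x. inverse (1 + x\<^sup>2) + (1 + x\<^sup>2) * (cmod (g x))\<^sup>2)"
    using assms by (simp add: weighted_L2_iff)
  show "AE x in lebesgue. norm (g x) \<le> norm (inverse (1 + x\<^sup>2) + (1 + x\<^sup>2) * (cmod (g x))\<^sup>2)"
  proof (rule AE_I2)
    fix x :: real
    define w where "w = sqrt (1 + x\<^sup>2)"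
    have w: "w > 0" "w\<^sup>2 = 1 + x\<^sup>2" by (auto simp: w_def add_pos_nonneg)
    have "0 \<le> (inverse w - w * cmod (g x))\<^sup>2 + (inverse w)\<^sup>2 + (w * cmod (g x))\<^sup>2" by simp
    also have "\<dots> = 2 * (inverse (w\<^sup>2) + w\<^sup>2 * (cmod (g x))\<^sup>2 - cmod (g x))"
      using w(1) by (simp add: power2_eq_square field_simps)
    finally have "cmod (g x) \<le> inverse (1 + x\<^sup>2) + (1 + x\<^sup>2) * (cmod (g x))\<^sup>2"
      unfolding w(2) by simp
    then show "norm (g x) \<le> norm (inverse (1 + x\<^sup>2) + (1 + x\<^sup>2) * (cmod (g x))\<^sup>2)" by simp
  qed
qed (use assms in \<open>simp add: weighted_L2_iff\<close>)

lemma ac_derivative_L1_bounded: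
  assumes u: "ac_derivative u g" and g: "integrable lebesgue g"
  obtains B where "\<And>x. norm (u x) \<le> B"
proof
  have step: "norm (u b - u a) \<le> (\<integral>x. norm (g x) \<partial>lebesgue)" if "a \<le> b" for a b
  proof -
    have ai: "g absolutely_integrable_on {a..b}" and hi: "(g has_integral (u b - u a)) {a..b}"
      using u that by (auto simp: ac_derivative_def)
    have "u b - u a = (LINT x:{a..b}|lebesgue. g x)"
      using set_lebesgue_integral_eq_integral(2)[OF ai] integral_unique[OF hi] by simp
    also have "norm \<dots> \<le> (\<integral>x. norm (indicator {a..b} x *\<^sub>R g x) \<partial>lebesgue)"
      unfolding set_lebesgue_integral_def by (rule integral_norm_bound)
    also have "\<dots> \<le> (\<integral>x. norm (g x) \<partial>lebesgue)"
      using ai g by (intro integral_mono integrable_norm) (auto simp: set_integrable_def indicator_def)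
    finally show ?thesis .
  qed
  fix x
  have "norm (u x - u 0) \<le> (\<integral>x. norm (g x) \<partial>lebesgue)"
    using step[of 0 x] step[of x 0] by (cases "0 \<le> x") (auto simp: norm_minus_commute)
  then show "norm (u x) \<le> norm (u 0) + (\<integral>x. norm (g x) \<partial>lebesgue)"
    using norm_triangle_sub[of "u x" "u 0"] by linarith
qed

section \<open>The scale of spaces and its multipliers\<close>

primrec X_ac :: "nat \<Rightarrow> (real \<Rightarrow> complex) set" where
  "X_ac 0 = weighted_L2"
| "X_ac (Suc k) = {u \<in> weighted_L2. \<exists>g\<in>X_ac k. ac_derivative u g}"

text \<open>A multiplier is bounded but need not decay, like \<open>sqrt (1 + |u|\<^sup>2)\<close>; only its derivative is
  required to be weighted square integrable.  The index counts the regularity of the derivative, so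
  that an element of \<open>X_ac (Suc k)\<close> is itself a multiplier of index \<open>k\<close>.\<close>

definition X_multiplier :: "nat \<Rightarrow> (real \<Rightarrow> complex) set" where
  "X_multiplier k = {s. bounded (range s) \<and> (\<exists>g\<in>X_ac k. ac_derivative s g)}"

lemma X_ac_SucI: "u \<in> weighted_L2 \<Longrightarrow> g \<in> X_ac k \<Longrightarrow> ac_derivative u g \<Longrightarrow> u \<in> X_ac (Suc k)"
  by auto

lemma X_ac_weighted_L2: "u \<in> X_ac k \<Longrightarrow> u \<in> weighted_L2"
  by (cases k) auto

lemma X_ac_Suc_subset: "X_ac (Suc k) \<subseteq> X_ac k"
  by (induction k) auto

lemma X_ac_mono: "j \<le> k \<Longrightarrow> X_ac k \<subseteq> X_ac j"
  using lift_Suc_antimono_le[of X_ac j k] X_ac_Suc_subset by blast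

lemma X_multiplier_mono: "j \<le> k \<Longrightarrow> X_multiplier k \<subseteq> X_multiplier j"
  using X_ac_mono by (fastforce simp: X_multiplier_def)

text \<open>Boundedness comes from the integrability of the derivative over the whole line.\<close>

lemma X_ac_Suc_subset_multiplier: "X_ac (Suc k) \<subseteq> X_multiplier k"
proof
  fix u assume "u \<in> X_ac (Suc k)"
  then obtain g where g: "g \<in> X_ac k" "ac_derivative u g" by auto
  obtain B where "\<And>x. norm (u x) \<le> B"
    using ac_derivative_L1_bounded[OF g(2) weighted_L2_integrable[OF X_ac_weighted_L2[OF g(1)]]] by blast
  then have "bounded (range u)" by (auto simp: bounded_iff)
  with g show "u \<in> X_multiplier k" by (auto simp: X_multiplier_def)
qed

lemma weighted_L2_mult_continuous:
  assumes "g \<in> weighted_L2" "continuous_on UNIV s" "bounded (range s)"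
  shows "(\<lambda>x. s x * g x) \<in> weighted_L2"
proof -
  obtain C where "\<And>x. cmod (s x) \<le> C" using assms(3) by (auto simp: bounded_iff)
  moreover have "s \<in> borel_measurable lebesgue"
    using borel_measurable_continuous_onI[OF assms(2)] by (intro measurable_completion) simp
  ultimately show ?thesis using weighted_L2_bounded_mult[OF assms(1)] by blast
qed

lemma X_ac_add: "u \<in> X_ac k \<Longrightarrow> v \<in> X_ac k \<Longrightarrow> (\<lambda>x. u x + v x) \<in> X_ac k"
proof (induction k arbitrary: u v)
  case (Suc k)
  then obtain g h where "g \<in> X_ac k" "ac_derivative u g" "h \<in> X_ac k" "ac_derivative v h" by auto
  with Suc show ?case
    by (intro X_ac_SucI[OF _ _ ac_derivative_add]) (auto intro: weighted_L2_add)
qed (simp add: weighted_L2_add)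

lemma X_ac_cnj: "u \<in> X_ac k \<Longrightarrow> (\<lambda>x. cnj (u x)) \<in> X_ac k"
proof (induction k arbitrary: u)
  case (Suc k)
  then obtain g where "g \<in> X_ac k" "ac_derivative u g" by auto
  with Suc show ?case
    by (intro X_ac_SucI[OF _ _ ac_derivative_bounded_linear[OF bounded_linear_cnj]])
      (auto intro: weighted_L2_cnj)
qed (simp add: weighted_L2_cnj)

text \<open>In the product rule \<open>(s u)' = s u' + u s'\<close>, the second term is handled by exchanging the roles
  of the two factors: \<open>u\<close> is now the multiplier and \<open>s'\<close> the element of the space.  The truncated
  subtraction covers order \<open>0\<close>, where boundedness and continuity of \<open>s\<close> suffice.\<close>

lemma X_ac_multiplier_mult: "s \<in> X_multiplier (k - 1) \<Longrightarrow> u \<in> X_ac k \<Longrightarrow> (\<lambda>x. s x * u x) \<in> X_ac k"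
proof (induction k arbitrary: s u)
  case 0
  then show ?case
    by (auto simp: X_multiplier_def intro: weighted_L2_mult_continuous ac_derivative_continuous)
next
  case (Suc k)
  then obtain g h where g: "g \<in> X_ac k" "ac_derivative s g" and h: "h \<in> X_ac k" "ac_derivative u h"
    by (auto simp: X_multiplier_def)
  have s: "s \<in> X_multiplier k" "s \<in> X_multiplier (k - 1)" using Suc.prems X_multiplier_mono[of "k-1" k] by auto
  have u: "u \<in> X_multiplier (k - 1)" "u \<in> weighted_L2"
    using Suc.prems X_ac_Suc_subset_multiplier[of k] X_multiplier_mono[of "k-1" k] by auto
  have "(\<lambda>x. s x * u x) \<in> weighted_L2"
    using s(1) u(2) g(2) by (auto simp: X_multiplier_def intro: weighted_L2_mult_continuous ac_derivative_continuous)
  moreover have "(\<lambda>x. s x * h x + u x * g x) \<in> X_ac k"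
    using Suc.IH s(2) u(1) g(1) h(1) by (intro X_ac_add) auto
  moreover have "ac_derivative (\<lambda>x. s x * u x) (\<lambda>x. s x * h x + u x * g x)"
    using ac_derivative_mult[OF g(2) h(2)] by (simp add: mult.commute)
  ultimately show ?case by auto
qed

text \<open>The chain rule for \<open>z \<mapsto> p (1 + |z|\<^sup>2)\<close>, which is continuously differentiable on the real
  plane although it is not holomorphic.\<close>

lemma ac_derivative_norm_function:
  fixes p p' :: "real \<Rightarrow> real" and u :: "real \<Rightarrow> complex"
  assumes u: "ac_derivative u g"
    and p: "\<And>y. y \<ge> 1 \<Longrightarrow> (p has_real_derivative p' y) (at y)"
    and p': "continuous_on {1..} p'"
  shows "ac_derivative (\<lambda>x. complex_of_real (p (1 + (cmod (u x))\<^sup>2)))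
           (\<lambda>x. complex_of_real (p' (1 + (cmod (u x))\<^sup>2)) * (cnj (u x) * g x + u x * cnj (g x)))"
proof -
  define H' :: "complex \<Rightarrow> complex \<Rightarrow>\<^sub>L complex"
    where "H' z = Blinfun (\<lambda>w. complex_of_real (p' (1 + (cmod z)\<^sup>2)) * (cnj z * w + z * cnj w))" for z
  have app: "blinfun_apply (H' z) = (\<lambda>w. complex_of_real (p' (1 + (cmod z)\<^sup>2)) * (cnj z * w + z * cnj w))" for z
    unfolding H'_def by (rule bounded_linear_Blinfun_apply)
      (intro bounded_linear_intros bounded_linear_compose[OF bounded_linear_mult_right] bounded_linear_cnj)
  have "continuous_on UNIV (\<lambda>z. p' (1 + (cmod z)\<^sup>2))"
    by (rule continuous_on_compose2[OF p']) (auto intro!: continuous_intros)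
  then have cont: "continuous_on UNIV H'"
    by (intro continuous_on_blinfun_componentwise) (simp add: app, intro continuous_intros)
  have "((\<lambda>z. complex_of_real (p (1 + (cmod z)\<^sup>2))) has_derivative blinfun_apply (H' z)) (at z)" for z
  proof -
    have "((\<lambda>z. 1 + z \<bullet> z) has_derivative (\<lambda>w. 2 * (z \<bullet> w))) (at z)"
      by (auto intro!: derivative_eq_intros simp: inner_commute)
    moreover have "(p has_derivative (\<lambda>t. t * p' (1 + z \<bullet> z))) (at (1 + z \<bullet> z))"
      using p[of "1 + z \<bullet> z"] by (simp add: has_field_derivative_def mult.commute[of _ "p' _"])
    ultimately have "((\<lambda>z. p (1 + z \<bullet> z)) has_derivative (\<lambda>w. 2 * (z \<bullet> w) * p' (1 + z \<bullet> z))) (at z)"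
      by (rule has_derivative_compose)
    from bounded_linear.has_derivative[OF bounded_linear_of_real this]
    have "((\<lambda>z. complex_of_real (p (1 + z \<bullet> z))) has_derivative
        (\<lambda>w. complex_of_real (2 * (z \<bullet> w) * p' (1 + z \<bullet> z)))) (at z)" .
    moreover have "complex_of_real (2 * (z \<bullet> w)) = cnj z * w + z * cnj w" for w
      by (simp add: complex_eq_iff inner_complex_def)
    ultimately show ?thesis
      unfolding app by (simp add: dot_square_norm mult.commute)
  qed
  from ac_derivative_compose[OF u this cont] show ?thesis by (simp add: app)
qed

text \<open>The derivative of \<open>s = sqrt (1 + |u|\<^sup>2)\<close> is \<open>R v / 2\<close>, where \<open>R\<close> is the derivative of \<open>|u|\<^sup>2\<close> and
  \<open>v = 1 / s\<close>.  So it is enough that \<open>v\<close> is a multiplier.  Its own derivative \<open>- v\<^sup>3 R / 2\<close> involves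
  \<open>v\<close> again, and therefore the regularity of \<open>v\<close> is raised one order at a time until it reaches
  that of \<open>R\<close>.\<close>

lemma X_multiplier_sqrt:
  assumes u: "u \<in> X_ac (Suc n)"
  shows "(\<lambda>x. complex_of_real (sqrt (1 + (cmod (u x))\<^sup>2))) \<in> X_multiplier n"
proof -
  let ?s = "\<lambda>x. sqrt (1 + (cmod (u x))\<^sup>2)"
  define v where "v x = complex_of_real (1 / ?s x)" for x
  obtain g where g: "g \<in> X_ac n" and ug: "ac_derivative u g" using u by auto
  have s_ge: "?s x \<ge> 1" for x by simp
  define R where "R x = cnj (u x) * g x + u x * cnj (g x)" for x
  have uM: "u \<in> X_multiplier n" "(\<lambda>x. cnj (u x)) \<in> X_multiplier n"
    using X_ac_Suc_subset_multiplier u X_ac_cnj[OF u] by blast+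
  then have R: "R \<in> X_ac n"
    unfolding R_def using g X_multiplier_mono[of "n-1" n] by (intro X_ac_add X_ac_multiplier_mult X_ac_cnj) auto
  have v_deriv: "ac_derivative v (\<lambda>x. complex_of_real (-1/2) * (v x * (v x * (v x * R x))))"
  proof -
    have "((\<lambda>y. 1 / sqrt y) has_real_derivative (-1/2) * (1 / sqrt y) ^ 3) (at y)" if "y \<ge> 1" for y :: real
      using that by (auto intro!: derivative_eq_intros simp: field_simps power3_eq_cube)
    moreover have "continuous_on {1..} (\<lambda>y. (-1/2) * (1 / sqrt y) ^ 3)"
      by (intro continuous_intros) auto
    ultimately have "ac_derivative (\<lambda>x. complex_of_real (1 / ?s x))
        (\<lambda>x. complex_of_real ((-1/2) * (1 / ?s x) ^ 3) * R x)"
      unfolding R_def by (rule ac_derivative_norm_function[OF ug])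
    moreover have "complex_of_real ((-1/2) * (1 / ?s x) ^ 3) * R x =
        complex_of_real (-1/2) * (v x * (v x * (v x * R x)))" for x
      by (simp only: v_def power3_eq_cube of_real_mult mult_ac)
    ultimately show ?thesis by (simp only: v_def[abs_def])
  qed
  have v_bound: "bounded (range v)"
  proof -
    have "\<bar>1 / t\<bar> \<le> 1" if "t \<ge> 1" for t :: real using that by simp
    then have "cmod (v x) \<le> 1" for x using s_ge[of x] by (simp only: v_def norm_of_real)
    then show ?thesis by (auto simp: bounded_iff)
  qed
  have v_cont: "continuous_on UNIV v" by (rule ac_derivative_continuous[OF v_deriv])
  have const: "(\<lambda>x. complex_of_real c * w x) \<in> X_ac k" if "w \<in> X_ac k" for c w k
    using that
  proof (induction k arbitrary: w)
    case 0
    then show ?case by (auto intro!: weighted_L2_mult_continuous)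
  next
    case (Suc k)
    then obtain h where "h \<in> X_ac k" "ac_derivative w h" by auto
    with Suc show ?case
      by (intro X_ac_SucI[OF _ _ ac_derivative_bounded_linear[OF bounded_linear_mult_right]])
        (auto intro!: weighted_L2_mult_continuous)
  qed
  have v: "v \<in> X_multiplier k" if "k \<le> n" for k
    using that
  proof (induction k)
    case 0
    have "R \<in> weighted_L2" using R X_ac_weighted_L2 by blast
    then have "(\<lambda>x. complex_of_real (-1/2) * (v x * (v x * (v x * R x)))) \<in> X_ac 0"
      using v_cont v_bound by (intro const) (auto intro!: weighted_L2_mult_continuous)
    with v_deriv v_bound show ?case unfolding X_multiplier_def by blast
  next
    case (Suc k)
    have "R \<in> X_ac (Suc k)" using R X_ac_mono[OF Suc.prems] by blast
    moreover have "v \<in> X_multiplier (Suc k - 1)" using Suc by simp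
    ultimately have "(\<lambda>x. complex_of_real (-1/2) * (v x * (v x * (v x * R x)))) \<in> X_ac (Suc k)"
      by (intro const X_ac_multiplier_mult)
    with v_deriv v_bound show ?case unfolding X_multiplier_def by blast
  qed
  have "ac_derivative (\<lambda>x. complex_of_real (?s x)) (\<lambda>x. complex_of_real (1 / 2) * (v x * R x))"
  proof -
    have "(sqrt has_real_derivative (1/2) * (1 / sqrt y)) (at y)" if "y \<ge> 1" for y :: real
      using that by (auto intro!: derivative_eq_intros simp: field_simps)
    moreover have "continuous_on {1..} (\<lambda>y. (1/2) * (1 / sqrt y))"
      by (intro continuous_intros) auto
    ultimately have "ac_derivative (\<lambda>x. complex_of_real (?s x))
        (\<lambda>x. complex_of_real ((1/2) * (1 / ?s x)) * R x)"
      unfolding R_def by (rule ac_derivative_norm_function[OF ug])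
    moreover have "complex_of_real ((1/2) * (1 / ?s x)) * R x = complex_of_real (1/2) * (v x * R x)" for x
      by (simp only: v_def of_real_mult mult_ac)
    ultimately show ?thesis by (simp only:)
  qed
  moreover have "(\<lambda>x. complex_of_real (1 / 2) * (v x * R x)) \<in> X_ac n"
    using v[of "n-1"] R by (intro const X_ac_multiplier_mult) auto
  moreover have "bounded (range (\<lambda>x. complex_of_real (?s x)))"
  proof -
    obtain B where B: "\<And>x. cmod (u x) \<le> B" using uM(1) by (auto simp: X_multiplier_def bounded_iff)
    have "(cmod (u x))\<^sup>2 \<le> B\<^sup>2" for x using B[of x] by (simp add: power_mono)
    then show ?thesis
      by (auto simp: bounded_iff intro!: exI[of _ "sqrt (1 + B\<^sup>2)"] real_sqrt_le_mono)
  qed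
  ultimately show ?thesis by (auto simp: X_multiplier_def)
qed

section \<open>Test functions and the lemma of du Bois-Reymond\<close>

lemma integrable_zero_intervals_imp_AE_zero:
  fixes h :: "real \<Rightarrow> complex"
  assumes h: "integrable lebesgue h" and zero: "\<And>a b. (LINT x:{a..b}|lebesgue. h x) = 0"
  shows "AE x in lebesgue. h x = 0"
proof -
  have hA: "set_integrable lebesgue A h" if "A \<in> sets lebesgue" for A
    using integrable_mult_indicator[OF that h] by (simp add: set_integrable_def)
  have cover: "(\<Union>n. {- real n..real n}) = UNIV"
  proof (intro set_eqI iffI UNIV_I)
    fix x :: real
    obtain n where "\<bar>x\<bar> \<le> real n" using real_arch_simple by blast
    then show "x \<in> (\<Union>n. {- real n..real n})" by (auto intro!: exI[of _ n])
  qed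
  have tot: "(\<integral>x. h x \<partial>lebesgue) = 0"
  proof -
    have "(\<lambda>n. LINT x:{- real n..real n}|lebesgue. h x) \<longlonglongrightarrow> (LINT x:(\<Union>n. {- real n..real n})|lebesgue. h x)"
    proof (rule set_integral_cont_up)
      show "incseq (\<lambda>n. {- real n..real n})" by (auto simp: incseq_def)
    qed (auto intro!: hA)
    then have "(\<lambda>n. 0) \<longlonglongrightarrow> (LINT x:UNIV|lebesgue. h x)" by (simp only: zero cover)
    from LIMSEQ_unique[OF this tendsto_const] show ?thesis by (simp add: set_lebesgue_integral_def)
  qed
  have borel: "(LINT x:A|lebesgue. h x) = 0" if "A \<in> sets borel" for A
    using that
  proof (induction A rule: borel_set_induct)
    case (compl A)
    then have A: "A \<in> sets lebesgue" by simp
    have "indicator (- A) x *\<^sub>R h x = h x - indicator A x *\<^sub>R h x" for x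
      by (simp add: indicator_def)
    then have "(LINT x:- A|lebesgue. h x) = (\<integral>x. h x \<partial>lebesgue) - (LINT x:A|lebesgue. h x)"
      using h hA[OF A] by (simp add: set_lebesgue_integral_def set_integrable_def)
    then show ?case using compl tot by (simp add: Compl_eq_Diff_UNIV[symmetric])
  next
    case (union f)
    have "(LINT x:(\<Union>i. f i)|lebesgue. h x) = (\<Sum>i. LINT x:f i|lebesgue. h x)"
      using union by (intro lebesgue_integral_countable_add hA) (auto simp: disjoint_family_on_def)
    then show ?case using union by simp
  qed (use zero in \<open>auto simp: set_lebesgue_integral_def\<close>)
  interpret sigma_finite_measure "lebesgue :: real measure"
  proof
    show "\<exists>A. countable A \<and> A \<subseteq> sets (lebesgue :: real measure) \<and> \<Union>A = space lebesgue \<and> (\<forall>a\<in>A. emeasure lebesgue a \<noteq> \<infinity>)"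
      by (intro exI[of _ "range (\<lambda>n. {- real n..real n})"]) (auto simp: cover)
  qed
  show ?thesis
  proof (rule density_zero[OF h])
    fix A assume "A \<in> sets (lebesgue :: real measure)"
    then obtain S N N' where A: "A = S \<union> N" "N \<subseteq> N'" "N' \<in> null_sets lborel" "S \<in> sets lborel"
      by (auto elim!: sets_completionE)
    have "AE x in lebesgue. x \<notin> N'"
      using A(3) by (intro AE_not_in) (simp add: null_sets_completionI)
    then have "AE x in lebesgue. indicator A x *\<^sub>R h x = indicator S x *\<^sub>R h x"
      by eventually_elim (use A in \<open>auto simp: indicator_def\<close>)
    then have "(LINT x:A|lebesgue. h x) = (LINT x:S|lebesgue. h x)"
      unfolding set_lebesgue_integral_def
      using h hA[OF \<open>A \<in> sets lebesgue\<close>] hA[of S] A(4)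
      by (intro integral_cong_AE) (auto simp: set_integrable_def)
    then show "(LINT x:A|lebesgue. h x) = 0" using borel[of S] A(4) by simp
  qed
qed

lemma locally_integrable_zero_intervals_imp_AE_zero:
  assumes h: "locally_integrable h" and zero: "\<And>a b. a < b \<Longrightarrow> (LINT x:{a..b}|lebesgue. h x) = 0"
  shows "AE x in lebesgue. h x = 0"
proof -
  have zero': "(LINT x:{a..b}|lebesgue. h x) = 0" for a b
  proof -
    consider "a < b" | "a = b" | "b < a" by linarith
    then show ?thesis
    proof cases
      case 2
      have "h absolutely_integrable_on {b..b}" using h unfolding locally_integrable_def by blast
      from set_lebesgue_integral_eq_integral(2)[OF this] 2 show ?thesis by simp
    qed (use zero in \<open>auto simp: set_lebesgue_integral_def\<close>)
  qed
  have "AE x in lebesgue. indicator {- real n..real n} x *\<^sub>R h x = 0" for n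
  proof (rule integrable_zero_intervals_imp_AE_zero)
    show "integrable lebesgue (\<lambda>x. indicator {- real n..real n} x *\<^sub>R h x)"
      using h by (auto simp: locally_integrable_def set_integrable_def)
    fix a b :: real
    have "indicator {a..b} x *\<^sub>R indicator {- real n..real n} x *\<^sub>R h x =
        indicator {max a (- real n)..min b (real n)} x *\<^sub>R h x" for x
      by (auto simp: indicator_def)
    then show "(LINT x:{a..b}|lebesgue. indicator {- real n..real n} x *\<^sub>R h x) = 0"
      using zero'[of "max a (- real n)" "min b (real n)"] by (simp only: set_lebesgue_integral_def)
  qed
  then have "AE x in lebesgue. \<forall>n. indicator {- real n..real n} x *\<^sub>R h x = 0"
    unfolding AE_all_countable by blast
  then show ?thesis
  proof eventually_elim
    case (elim x)
    obtain n where "\<bar>x\<bar> \<le> real n" using real_arch_simple by blast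
    then show ?case using elim[rule_format, of n] by (simp add: indicator_def)
  qed
qed

text \<open>The bump \<open>exp (- c / ((x - a) (b - x)))\<close> on \<open>{a<..<b}\<close>, multiplied by a rational factor whose only
  poles are the endpoints.  For fixed \<open>a < b\<close> and \<open>c > 0\<close>, this class of functions is closed under
  differentiation, hence consists of smooth functions.\<close>

definition bump_term :: "real \<Rightarrow> real \<Rightarrow> real \<Rightarrow> real poly \<Rightarrow> nat \<Rightarrow> real \<Rightarrow> real" where
  "bump_term a b c P k x =
     (if a < x \<and> x < b then exp (- c / ((x - a) * (b - x))) * poly P x / ((x - a) * (b - x)) ^ k else 0)"

abbreviation bump :: "real \<Rightarrow> real \<Rightarrow> real \<Rightarrow> real \<Rightarrow> real" where
  "bump a b c \<equiv> bump_term a b c 1 0"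

lemma isCont_exp_inverse_power:
  fixes c :: real
  assumes c: "c > 0"
  shows "isCont (\<lambda>q. if q > 0 then exp (- c / q) / q ^ k else 0) 0"
proof -
  have lim: "filterlim (\<lambda>q. c / q) at_top (at_right 0)"
  proof -
    have "filterlim (\<lambda>q. c * inverse q) at_top (at_right 0)"
      by (rule filterlim_tendsto_pos_mult_at_top[OF tendsto_const c filterlim_inverse_at_top_right])
    then show ?thesis by (simp add: divide_inverse)
  qed
  have "((\<lambda>q. (1 / c ^ k) * ((c / q) ^ k / exp (c / q))) \<longlongrightarrow> (1 / c ^ k) * 0) (at_right 0)"
    by (intro tendsto_mult tendsto_const filterlim_compose[OF tendsto_power_div_exp_0 lim])
  then have "((\<lambda>q. (1 / c ^ k) * ((c / q) ^ k / exp (c / q))) \<longlongrightarrow> 0) (at_right 0)" by simp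
  moreover have "\<forall>\<^sub>F q in at_right 0. (1 / c ^ k) * ((c / q) ^ k / exp (c / q))
      = (if q > 0 then exp (- c / q) / q ^ k else 0)"
    using eventually_at_right_less[of "0::real"]
    by eventually_elim (use c in \<open>auto simp: power_divide exp_minus field_simps\<close>)
  ultimately have R: "((\<lambda>q. if q > 0 then exp (- c / q) / q ^ k else 0) \<longlongrightarrow> 0) (at_right 0)"
    by (rule Lim_transform_eventually)
  have L: "((\<lambda>q. if q > 0 then exp (- c / q) / q ^ k else 0) \<longlongrightarrow> 0) (at_left 0)"
  proof (rule tendsto_eventually)
    show "\<forall>\<^sub>F q in at_left 0. (if q > 0 then exp (- c / q) / q ^ k else 0) = 0"
      unfolding eventually_at_left_field by (auto intro!: exI[of _ "-1"])
  qed
  show ?thesis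
    unfolding isCont_def using filterlim_split_at[OF L R] by simp
qed

text \<open>Inside the interval this is the quotient rule.  At an endpoint, the difference quotient is bounded
  by \<open>exp (- c / Q) / Q ^ (k + 1)\<close> up to a bounded factor, where \<open>Q = (x - a) (b - x)\<close> tends to \<open>0\<close>.\<close>

lemma bump_term_has_derivative:
  fixes a b c :: real
  assumes ab: "a < b" and c: "c > 0"
  shows "\<exists>P'. \<forall>x. (bump_term a b c P k has_real_derivative bump_term a b c P' (k + 2) x) (at x)"
proof -
  define Q where "Q = [:-a, 1:] * [:b, -1:]"
  have Q: "poly Q x = (x - a) * (b - x)" for x
    by (simp add: Q_def algebra_simps)
  define P' where "P' = smult c (pderiv Q) * P + pderiv P * Q\<^sup>2 - smult (real k) (P * pderiv Q * Q)"
  define F where "F = bump_term a b c P k"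
  have F: "F x = (if a < x \<and> x < b then exp (- c / poly Q x) * poly P x / poly Q x ^ k else 0)" for x
    by (simp add: F_def bump_term_def Q)
  have Qpos: "poly Q x > 0" if "a < x" "x < b" for x using that by (simp add: Q)
  have "(F has_real_derivative bump_term a b c P' (k + 2) x) (at x)" for x
  proof -
    consider "a < x \<and> x < b" | "x < a \<or> b < x" | "x = a \<or> x = b" by linarith
    then show ?thesis
    proof cases
      case 1
      define q where "q = poly Q x"
      have q: "q > 0" using Qpos 1 by (simp add: q_def)
      have "((\<lambda>y. exp (- c / poly Q y) * poly P y / poly Q y ^ k) has_real_derivative
          exp (- c / q) * (c * poly (pderiv Q) x * poly P x + poly (pderiv P) x * q\<^sup>2
             - real k * (poly P x * poly (pderiv Q) x * q)) / q ^ (k + 2)) (at x)"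
        using q by (auto intro!: derivative_eq_intros simp: q_def[symmetric])
          (cases k; simp add: field_simps power2_eq_square)
      then have "((\<lambda>y. exp (- c / poly Q y) * poly P y / poly Q y ^ k) has_real_derivative
          bump_term a b c P' (k + 2) x) (at x)"
        using 1 by (simp add: bump_term_def P'_def q_def Q[symmetric] mult.assoc)
      then show ?thesis
        by (rule has_field_derivative_transform_within_open[of _ _ _ "{a<..<b}"]) (use 1 F in auto)
    next
      case 2
      have "((\<lambda>y. 0) has_real_derivative bump_term a b c P' (k + 2) x) (at x)"
        using 2 by (auto simp: bump_term_def)
      moreover have "open ({..<a} \<union> {b<..})" by auto
      ultimately show ?thesis
        by (rule has_field_derivative_transform_within_open) (use 2 F in auto)
    next
      case 3
      define G where "G q = (if q > 0 then exp (- c / q) / q ^ (k + 1) else 0)" for q :: real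
      have "isCont G 0" unfolding G_def using isCont_exp_inverse_power[OF c] .
      moreover have "(poly Q \<longlongrightarrow> 0) (at x)"
      proof -
        have "isCont (poly Q) x" by (rule poly_isCont)
        moreover have "poly Q x = 0" using 3 by (auto simp: Q)
        ultimately show ?thesis by (simp only: isCont_def)
      qed
      moreover have "G 0 = 0" by (simp add: G_def)
      ultimately have "((\<lambda>y. G (poly Q y)) \<longlongrightarrow> 0) (at x)"
        using isCont_tendsto_compose by fastforce
      moreover have "isCont (\<lambda>y. \<bar>poly P y\<bar> * (b - a)) x" by (intro continuous_intros)
      then have "((\<lambda>y. \<bar>poly P y\<bar> * (b - a)) \<longlongrightarrow> \<bar>poly P x\<bar> * (b - a)) (at x)"
        by (simp only: isCont_def)
      ultimately have lim: "((\<lambda>y. G (poly Q y) * (\<bar>poly P y\<bar> * (b - a))) \<longlongrightarrow> 0) (at x)"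
        using tendsto_mult by fastforce
      have le: "\<bar>(F y - F x) / (y - x)\<bar> \<le> G (poly Q y) * (\<bar>poly P y\<bar> * (b - a))" for y
      proof (cases "a < y \<and> y < b")
        case True
        define q where "q = poly Q y"
        have q: "q > 0" using Qpos True by (simp add: q_def)
        have "q / (b - a) \<le> \<bar>y - x\<bar>"
        proof -
          have "q \<le> \<bar>y - x\<bar> * (b - a)"
            using 3
          proof
            assume "x = a"
            then show ?thesis using True mult_left_mono[of "b - y" "b - a" "y - a"] by (simp add: q_def Q)
          next
            assume "x = b"
            then show ?thesis using True mult_right_mono[of "y - a" "b - a" "b - y"]
              by (simp add: q_def Q mult.commute)
          qed
          then show ?thesis using ab by (simp add: divide_le_eq)
        qed
        then have "1 / \<bar>y - x\<bar> \<le> (b - a) / q"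
        proof -
          assume "q / (b - a) \<le> \<bar>y - x\<bar>"
          then have "1 / \<bar>y - x\<bar> \<le> 1 / (q / (b - a))"
            using frac_le[of 1 1 "q / (b - a)" "\<bar>y - x\<bar>"] q ab by simp
          then show ?thesis by simp
        qed
        then have "\<bar>F y\<bar> * (1 / \<bar>y - x\<bar>) \<le> \<bar>F y\<bar> * ((b - a) / q)"
          by (rule mult_left_mono) simp
        also have "\<dots> = G q * (\<bar>poly P y\<bar> * (b - a))"
          using q True by (simp add: F G_def q_def[symmetric] abs_mult mult_ac)
        finally show ?thesis using 3 by (auto simp: F q_def)
      qed (use 3 ab in \<open>auto simp: F G_def\<close>)
      have "((\<lambda>y. (F y - F x) / (y - x)) \<longlongrightarrow> 0) (at x)"
      proof (rule tendsto_0_le[OF lim, of _ 1], rule always_eventually, rule allI)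
        show "norm ((F y - F x) / (y - x)) \<le> norm (G (poly Q y) * (\<bar>poly P y\<bar> * (b - a))) * 1" for y
          using order_trans[OF le[of y] abs_ge_self] by (simp only: real_norm_def mult_1_right)
      qed
      moreover have "bump_term a b c P' (k + 2) x = 0" using 3 by (auto simp: bump_term_def)
      ultimately show ?thesis by (simp add: has_field_derivative_iff)
    qed
  qed
  then show ?thesis unfolding F_def by blast
qed

lemma test_function_bump:
  assumes ab: "a < b" and c: "c > 0"
  shows "test_function (bump a b c)"
proof -
  have "\<exists>P k. (deriv ^^ n) (bump a b c) = bump_term a b c P k" for n
  proof (induction n)
    case (Suc n)
    then obtain P k where Pk: "(deriv ^^ n) (bump a b c) = bump_term a b c P k" by blast
    obtain P' where "\<And>x. (bump_term a b c P k has_real_derivative bump_term a b c P' (k + 2) x) (at x)"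
      using bump_term_has_derivative[OF ab c] by blast
    then have "deriv (bump_term a b c P k) = bump_term a b c P' (k + 2)"
      by (intro ext DERIV_imp_deriv)
    with Pk show ?case by auto
  qed auto
  moreover have "bump_term a b c P k differentiable_on UNIV" for P k
    using bump_term_has_derivative[OF ab c, of P k]
    by (auto simp: differentiable_on_def real_differentiable_def)
  ultimately have "(deriv ^^ n) (bump a b c) differentiable_on UNIV" for n by metis
  moreover have "{x. bump a b c x \<noteq> 0} \<subseteq> {a..b}"
    by (auto simp: bump_term_def split: if_splits)
  then have "bounded {x. bump a b c x \<noteq> 0}" using bounded_closed_interval bounded_subset by blast
  ultimately show ?thesis by (simp add: test_function_def)
qed

lemma test_function_has_derivative:
  assumes "test_function \<phi>"
  shows "((deriv ^^ n) \<phi> has_real_derivative (deriv ^^ Suc n) \<phi> x) (at x)"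
proof -
  have "(deriv ^^ n) \<phi> field_differentiable at x"
    using assms by (auto simp: test_function_def differentiable_on_def field_differentiable_def real_differentiable_def)
  then show ?thesis by (simp add: DERIV_deriv_iff_field_differentiable)
qed

lemma test_function_continuous:
  assumes "test_function \<phi>" shows "continuous_on S \<phi>"
  using DERIV_isCont[OF test_function_has_derivative[OF assms, of 0]]
  by (auto intro: continuous_at_imp_continuous_on)

lemma test_function_support:
  assumes "test_function \<phi>"
  obtains R where "R > 0" "\<And>x. R \<le> \<bar>x\<bar> \<Longrightarrow> \<phi> x = 0"
proof -
  have "bounded {x. \<phi> x \<noteq> 0}" using assms by (simp add: test_function_def)
  then obtain B where B: "B > 0" "\<And>x. \<phi> x \<noteq> 0 \<Longrightarrow> \<bar>x\<bar> \<le> B" unfolding bounded_pos by auto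
  show ?thesis
  proof (rule that[of "B + 1"])
    show "\<phi> x = 0" if "B + 1 \<le> \<bar>x\<bar>" for x
      using B(2)[of x] that by (cases "\<phi> x = 0") auto
  qed (use B(1) in simp)
qed

lemma test_function_deriv:
  assumes "test_function \<phi>"
  shows "test_function (deriv \<phi>)"
proof -
  obtain R where R: "R > 0" "\<And>x. R \<le> \<bar>x\<bar> \<Longrightarrow> \<phi> x = 0" using test_function_support[OF assms] by blast
  have "deriv \<phi> x = 0" if "x \<notin> {-R..R}" for x
  proof -
    have "((\<lambda>y. 0) has_real_derivative 0) (at x)" by simp
    moreover have "open (- {-R..R})" by (intro open_Compl closed_atLeastAtMost)
    ultimately have "(\<phi> has_real_derivative 0) (at x)"
      by (rule has_field_derivative_transform_within_open) (use that R in auto)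
    then show ?thesis by (rule DERIV_imp_deriv)
  qed
  then have "{x. deriv \<phi> x \<noteq> 0} \<subseteq> {-R..R}" by blast
  then have "bounded {x. deriv \<phi> x \<noteq> 0}" using bounded_closed_interval bounded_subset by blast
  moreover have "(deriv ^^ n) (deriv \<phi>) differentiable_on UNIV" for n
  proof -
    have "(deriv ^^ n) (deriv \<phi>) = (deriv ^^ Suc n) \<phi>" by (simp only: funpow_Suc_right o_apply)
    then show ?thesis using assms by (simp only: test_function_def)
  qed
  ultimately show ?thesis by (simp add: test_function_def)
qed

lemma test_function_deriv_iterate: "test_function \<phi> \<Longrightarrow> test_function ((deriv ^^ n) \<phi>)"
  by (induction n) (auto intro: test_function_deriv)

lemma test_function_combination:
  assumes f: "test_function f" and g: "test_function g"
  shows "test_function (\<lambda>x. f x - k * g x)"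
proof -
  have D: "((\<lambda>x. (deriv ^^ n) f x - k * (deriv ^^ n) g x) has_real_derivative
      ((deriv ^^ Suc n) f x - k * (deriv ^^ Suc n) g x)) (at x)" for n x
    by (intro DERIV_diff DERIV_cmult test_function_has_derivative assms)
  have eq: "(deriv ^^ n) (\<lambda>x. f x - k * g x) = (\<lambda>x. (deriv ^^ n) f x - k * (deriv ^^ n) g x)" for n
  proof (induction n)
    case (Suc n)
    then show ?case using DERIV_imp_deriv[OF D[of n]] by auto
  qed simp
  have "(deriv ^^ n) (\<lambda>x. f x - k * g x) differentiable_on UNIV" for n
    unfolding eq using D[of n] by (auto simp only: differentiable_on_def real_differentiable_def)
  moreover have "bounded ({x. f x \<noteq> 0} \<union> {x. g x \<noteq> 0})"
    using f g by (simp add: test_function_def)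
  then have "bounded {x. f x - k * g x \<noteq> 0}" by (rule bounded_subset) auto
  ultimately show ?thesis by (simp add: test_function_def)
qed

text \<open>A primitive of a compactly supported function is constant on both sides of the support; with
  vanishing integral, both constants can be made \<open>0\<close>.\<close>

lemma test_function_antiderivative:
  assumes \<psi>: "test_function \<psi>" and mean: "(\<integral>x. \<psi> x \<partial>lebesgue) = 0"
  obtains \<phi> where "test_function \<phi>" "deriv \<phi> = \<psi>"
proof -
  obtain R where R: "R > 0" "\<And>x. R \<le> \<bar>x\<bar> \<Longrightarrow> \<psi> x = 0" using test_function_support[OF \<psi>] by blast
  have cont: "isCont \<psi> x" for x
    using DERIV_isCont[OF test_function_has_derivative[OF \<psi>, of 0]] by simp
  have "\<exists>F. \<forall>x. (-\<infinity>::ereal) < ereal x \<longrightarrow> ereal x < \<infinity> \<longrightarrow> (F has_vector_derivative \<psi> x) (at x)"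
    by (rule einterval_antiderivative) (simp_all add: cont)
  then obtain F where "\<And>x. (F has_vector_derivative \<psi> x) (at x)" by auto
  then have F: "(F has_real_derivative \<psi> x) (at x)" for x
    by (simp only: has_real_derivative_iff_has_vector_derivative)
  define \<phi> where "\<phi> x = F x - F (-R)" for x
  have \<phi>: "(\<phi> has_real_derivative \<psi> x) (at x)" for x
    unfolding \<phi>_def using F by (auto intro!: derivative_eq_intros)
  then have d: "deriv \<phi> = \<psi>" by (intro ext DERIV_imp_deriv)
  have I: "(\<psi> has_integral (F R - F (-R))) {-R..R}"
  proof (rule fundamental_theorem_of_calculus)
    show "(F has_vector_derivative \<psi> x) (at x within {-R..R})" for x
      using has_field_derivative_at_within[OF F[of x]]
      by (simp only: has_real_derivative_iff_has_vector_derivative)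
  qed (use R(1) in simp)
  have "(\<psi> has_integral 0) {-R..R}"
  proof -
    have ai: "\<psi> absolutely_integrable_on {-R..R}"
      by (intro absolutely_integrable_continuous_real test_function_continuous[OF \<psi>])
    have "indicator {-R..R} x *\<^sub>R \<psi> x = \<psi> x" for x
      using R(2)[of x] by (cases "R \<le> \<bar>x\<bar>") (auto simp: indicator_def)
    then have "(LINT x:{-R..R}|lebesgue. \<psi> x) = 0"
      using mean by (simp only: set_lebesgue_integral_def)
    then show ?thesis using has_integral_set_lebesgue[OF ai] by simp
  qed
  from has_integral_unique[OF I this] have FR: "F R = F (-R)" by simp
  have const: "F x = F y" if "x \<le> y" "\<And>z. x \<le> z \<Longrightarrow> z \<le> y \<Longrightarrow> \<psi> z = 0" for x y
  proof (cases "x = y")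
    case False
    then have "x < y" using that by simp
    then obtain z where "x < z" "z < y" "F y - F x = (y - x) * \<psi> z"
      using MVT2[of x y F \<psi>] F by blast
    then show ?thesis using that(2)[of z] by simp
  qed simp
  have "\<phi> x = 0" if "x \<notin> {-R..R}" for x
  proof (cases "x < -R")
    case True
    then have "F x = F (-R)" using R by (intro const) auto
    then show ?thesis by (simp add: \<phi>_def)
  next
    case False
    with that have "R \<le> x" by simp
    then have "F R = F x" using R by (intro const) auto
    then show ?thesis using FR by (simp add: \<phi>_def)
  qed
  then have "{x. \<phi> x \<noteq> 0} \<subseteq> {-R..R}" by blast
  then have "bounded {x. \<phi> x \<noteq> 0}" using bounded_closed_interval bounded_subset by blast
  moreover have "(deriv ^^ n) \<phi> differentiable_on UNIV" for n
  proof (cases n)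
    case 0
    then show ?thesis using \<phi> by (auto simp: differentiable_on_def real_differentiable_def)
  next
    case (Suc k)
    then have "(deriv ^^ n) \<phi> = (deriv ^^ k) \<psi>" by (simp only: funpow_Suc_right o_apply d)
    then show ?thesis using \<psi> by (simp add: test_function_def)
  qed
  ultimately show ?thesis using that[OF _ d] by (simp add: test_function_def)
qed

lemma integrable_mult_test:
  assumes h: "locally_integrable h" and \<phi>: "test_function \<phi>"
  shows "integrable lebesgue (\<lambda>x. h x * of_real (\<phi> x))"
proof -
  obtain R where R: "R > 0" "\<And>x. R \<le> \<bar>x\<bar> \<Longrightarrow> \<phi> x = 0" using test_function_support[OF \<phi>] by blast
  have hR: "integrable lebesgue (\<lambda>x. indicator {-R..R} x *\<^sub>R h x)"
    using h by (auto simp: locally_integrable_def set_integrable_def)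
  have "bounded (\<phi> ` {-R..R})"
    by (intro compact_imp_bounded compact_continuous_image test_function_continuous[OF \<phi>]) simp
  then obtain C where C: "\<And>x. x \<in> {-R..R} \<Longrightarrow> \<bar>\<phi> x\<bar> \<le> C"
    unfolding bounded_iff real_norm_def by (metis image_eqI)
  have eq: "h x * of_real (\<phi> x) = (indicator {-R..R} x *\<^sub>R h x) * of_real (\<phi> x)" for x
    using R(2)[of x] by (cases "R \<le> \<bar>x\<bar>") (auto simp: indicator_def)
  have meas: "(\<lambda>x. complex_of_real (\<phi> x)) \<in> borel_measurable lebesgue"
    by (rule measurable_completion)
      (use borel_measurable_continuous_onI[OF continuous_on_of_real[OF test_function_continuous[OF \<phi>]]] in simp)
  have "integrable lebesgue (\<lambda>x. (indicator {-R..R} x *\<^sub>R h x) * of_real (\<phi> x))"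
  proof (rule Bochner_Integration.integrable_bound)
    show "integrable lebesgue (\<lambda>x. C * norm (indicator {-R..R} x *\<^sub>R h x))"
      using hR by (intro integrable_mult_right integrable_norm)
    show "(\<lambda>x. (indicator {-R..R} x *\<^sub>R h x) * of_real (\<phi> x)) \<in> borel_measurable lebesgue"
      using hR meas by (intro borel_measurable_times) auto
    have "norm ((indicator {-R..R} x *\<^sub>R h x) * of_real (\<phi> x)) \<le> \<bar>C * norm (indicator {-R..R} x *\<^sub>R h x)\<bar>" for x
    proof (cases "x \<in> {-R..R}")
      case True
      then have "cmod (h x) * \<bar>\<phi> x\<bar> \<le> cmod (h x) * C" by (intro mult_left_mono C) auto
      also have "\<dots> \<le> \<bar>cmod (h x) * C\<bar>" by simp
      finally show ?thesis using True by (simp add: norm_mult mult.commute)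
    qed simp
    then show "AE x in lebesgue. norm ((indicator {-R..R} x *\<^sub>R h x) * of_real (\<phi> x))
        \<le> norm (C * norm (indicator {-R..R} x *\<^sub>R h x))"
      by simp
  qed
  then show ?thesis by (simp only: eq[symmetric])
qed

lemma locally_integrable_const: "locally_integrable (\<lambda>x. c)"
  unfolding locally_integrable_def by simp

lemma locally_integrable_diff:
  "locally_integrable f \<Longrightarrow> locally_integrable g \<Longrightarrow> locally_integrable (\<lambda>x. f x - g x)"
  by (auto simp: locally_integrable_def)

lemma integrable_test: "test_function \<phi> \<Longrightarrow> integrable lebesgue \<phi>"
  using integrable_Re[OF integrable_mult_test[OF locally_integrable_const[of 1]]] by simp

lemma bump_integral_pos:
  assumes "a < b" "c > 0"
  shows "(\<integral>x. bump a b c x \<partial>lebesgue) > 0"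
proof -
  note t = test_function_bump[OF assms]
  have nn: "bump a b c x \<ge> 0" for x by (simp add: bump_term_def)
  have "(\<integral>x. bump a b c x \<partial>lebesgue) \<noteq> 0"
  proof
    assume "(\<integral>x. bump a b c x \<partial>lebesgue) = 0"
    then have "AE x in lebesgue. bump a b c x = 0"
      using integral_nonneg_eq_0_iff_AE[OF integrable_test[OF t]] nn by simp
    then have "AE x in lebesgue. x \<notin> {a<..<b}"
      by eventually_elim (auto simp: bump_term_def)
    then have "{a<..<b} \<in> null_sets lebesgue"
      using AE_iff_null_sets[of "{a<..<b}" lebesgue] by simp
    then show False using assms by (simp add: null_sets_def)
  qed
  moreover have "(\<integral>x. bump a b c x \<partial>lebesgue) \<ge> 0" using nn by simp
  ultimately show ?thesis by linarith
qed

lemma bump_limit: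
  "(\<lambda>n. bump a b (1 / real (Suc n)) x) \<longlonglongrightarrow> indicator {a<..<b} x"
proof (cases "a < x \<and> x < b")
  case True
  have "(\<lambda>n. exp (- (inverse (real (Suc n)) / ((x - a) * (b - x))))) \<longlonglongrightarrow> exp (- (0 / ((x - a) * (b - x))))"
    using True by (intro tendsto_intros LIMSEQ_inverse_real_of_nat) auto
  then show ?thesis using True by (simp add: bump_term_def divide_inverse)
qed (auto simp: bump_term_def)

lemma bump_le_1: "c \<ge> 0 \<Longrightarrow> \<bar>bump a b c x\<bar> \<le> indicator {a..b} x"
  by (auto simp: bump_term_def)

text \<open>A fixed bump \<open>\<eta>\<close> serves as a reference.  Subtracting from another bump a multiple of \<open>\<eta>\<close> with the
  same integral leaves a derivative of a test function, on which \<open>h\<close> vanishes.  So \<open>h\<close> tested with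
  any bump is \<open>k\<close> times the integral of the bump, with \<open>k\<close> depending on \<open>\<eta>\<close> only.  Letting the
  bumps fill up intervals, the integrals of \<open>h\<close> and of the constant \<open>k\<close> agree on every interval.\<close>

lemma du_Bois_Reymond:
  assumes h: "locally_integrable h"
    and zero: "\<And>\<phi>. test_function \<phi> \<Longrightarrow> (\<integral>x. h x * of_real (deriv \<phi> x) \<partial>lebesgue) = 0"
  obtains k where "AE x in lebesgue. h x = k"
proof -
  let ?\<eta> = "bump 0 1 1"
  have \<eta>: "test_function ?\<eta>" by (rule test_function_bump) auto
  define I where "I = (\<integral>x. ?\<eta> x \<partial>lebesgue)"
  have I: "I > 0" unfolding I_def by (rule bump_integral_pos) auto
  \<comment> \<open>the only candidate for the constant, as seen by testing with the reference bump\<close>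
  define k where "k = (\<integral>x. h x * of_real (?\<eta> x) \<partial>lebesgue) / of_real I"
  have interval: "(LINT x:{a..b}|lebesgue. h x) = of_real (b - a) * k" if ab: "a < b" for a b
  proof -
    define T where "T n = bump a b (1 / real (Suc n))" for n
    have T: "test_function (T n)" for n unfolding T_def using ab by (intro test_function_bump) auto
    have T_eq: "(\<integral>x. h x * of_real (T n x) \<partial>lebesgue) = of_real (\<integral>x. T n x \<partial>lebesgue) * k" for n
    proof -
      define r where "r = (\<integral>x. T n x \<partial>lebesgue) / I"
      have \<psi>: "test_function (\<lambda>x. T n x - r * ?\<eta> x)" by (rule test_function_combination[OF T \<eta>])
      have "(\<integral>x. T n x - r * ?\<eta> x \<partial>lebesgue) = 0"
        using integrable_test[OF T] integrable_test[OF \<eta>] I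
        by (simp add: r_def I_def[symmetric])
      from test_function_antiderivative[OF \<psi> this] obtain \<phi>
        where "test_function \<phi>" "deriv \<phi> = (\<lambda>x. T n x - r * ?\<eta> x)" by blast
      from zero[OF this(1)] this(2)
      have "0 = (\<integral>x. h x * of_real (T n x) - of_real r * (h x * of_real (?\<eta> x)) \<partial>lebesgue)"
        by (simp add: algebra_simps)
      also have "\<dots> = (\<integral>x. h x * of_real (T n x) \<partial>lebesgue) - of_real r * (\<integral>x. h x * of_real (?\<eta> x) \<partial>lebesgue)"
        using integrable_mult_test[OF h T] integrable_mult_test[OF h \<eta>] by simp
      finally show ?thesis by (simp add: r_def k_def)
    qed
    have T_le: "\<bar>T n x\<bar> \<le> indicator {a..b} x" for n x
      unfolding T_def by (rule bump_le_1) simp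
    have T_lim: "(\<lambda>n. T n x) \<longlonglongrightarrow> indicator {a<..<b} x" for x
      unfolding T_def by (rule bump_limit)
    have hab: "integrable lebesgue (\<lambda>x. indicator {a..b} x *\<^sub>R h x)"
      using h by (auto simp: locally_integrable_def set_integrable_def)
    have hab': "integrable lebesgue (\<lambda>x. indicator {a<..<b} x *\<^sub>R h x)"
      using set_integrable_subset[of lebesgue "{a..b}" h "{a<..<b}"] hab by (force simp: set_integrable_def)
    have "(\<lambda>n. \<integral>x. h x * of_real (T n x) \<partial>lebesgue) \<longlonglongrightarrow> (\<integral>x. indicator {a<..<b} x *\<^sub>R h x \<partial>lebesgue)"
    proof (rule integral_dominated_convergence)
      show "(\<lambda>x. indicator {a<..<b} x *\<^sub>R h x) \<in> borel_measurable lebesgue" using hab' by auto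
      show "(\<lambda>x. h x * of_real (T n x)) \<in> borel_measurable lebesgue" for n
        using integrable_mult_test[OF h T] by auto
      show "integrable lebesgue (\<lambda>x. norm (indicator {a..b} x *\<^sub>R h x))" using hab by (rule integrable_norm)
      have "(\<lambda>n. h x * of_real (T n x)) \<longlonglongrightarrow> h x * of_real (indicator {a<..<b} x)" for x
        by (intro tendsto_intros T_lim)
      then show "AE x in lebesgue. (\<lambda>n. h x * of_real (T n x)) \<longlonglongrightarrow> indicator {a<..<b} x *\<^sub>R h x"
        by (simp add: scaleR_conv_of_real mult.commute)
      have "norm (h x * of_real (T n x)) \<le> norm (indicator {a..b} x *\<^sub>R h x)" for n x
        using mult_left_mono[OF T_le[of n x], of "norm (h x)"] by (simp add: norm_mult mult.commute)
      then show "AE x in lebesgue. norm (h x * of_real (T n x)) \<le> norm (indicator {a..b} x *\<^sub>R h x)" for n by simp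
    qed
    moreover have "(\<lambda>n. \<integral>x. T n x \<partial>lebesgue) \<longlonglongrightarrow> (\<integral>x. indicator {a<..<b} x \<partial>lebesgue)"
    proof (rule integral_dominated_convergence)
      show "integrable lebesgue (indicator {a..b} :: real \<Rightarrow> real)"
        by (rule integrable_real_indicator) (use ab in auto)
      show "T n \<in> borel_measurable lebesgue" for n using integrable_test[OF T] by auto
      show "(indicator {a<..<b} :: real \<Rightarrow> real) \<in> borel_measurable lebesgue"
        by (rule borel_measurable_indicator) simp
    qed (use T_lim T_le in auto)
    then have "(\<lambda>n. \<integral>x. h x * of_real (T n x) \<partial>lebesgue) \<longlonglongrightarrow> of_real (b - a) * k"
      unfolding T_eq using ab by (intro tendsto_intros) (simp add: tendsto_of_real_iff)
    ultimately have "(\<integral>x. indicator {a<..<b} x *\<^sub>R h x \<partial>lebesgue) = of_real (b - a) * k"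
      by (rule LIMSEQ_unique)
    moreover have "AE x in lebesgue. x \<noteq> a" "AE x in lebesgue. x \<noteq> b"
      using AE_not_in[of "{a}" lebesgue] AE_not_in[of "{b}" lebesgue] by auto
    then have "AE x in lebesgue. indicator {a<..<b} x *\<^sub>R h x = indicator {a..b} x *\<^sub>R h x"
      by eventually_elim (auto simp: indicator_def)
    then have "(\<integral>x. indicator {a<..<b} x *\<^sub>R h x \<partial>lebesgue) = (LINT x:{a..b}|lebesgue. h x)"
      unfolding set_lebesgue_integral_def using hab hab' by (intro integral_cong_AE) auto
    ultimately show ?thesis by simp
  qed
  have "AE x in lebesgue. h x - k = 0"
  proof (rule locally_integrable_zero_intervals_imp_AE_zero)
    show "locally_integrable (\<lambda>x. h x - k)"
      using locally_integrable_diff[OF h locally_integrable_const] .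
    fix a b :: real assume ab: "a < b"
    have "(LINT x:{a..b}|lebesgue. h x - k) = (LINT x:{a..b}|lebesgue. h x) - (LINT x:{a..b}|lebesgue. k)"
      using h by (intro set_integral_diff) (auto simp: locally_integrable_def)
    also have "(LINT x:{a..b}|lebesgue. k) = of_real (b - a) * k"
      using ab by (simp add: set_lebesgue_integral_def scaleR_conv_of_real)
    finally show "(LINT x:{a..b}|lebesgue. h x - k) = 0" using interval[OF ab] by simp
  qed
  then show ?thesis using that[of k] by simp
qed

section \<open>Weak derivatives and absolutely continuous representatives\<close>

lemma ac_derivative_locally_integrable:
  assumes "ac_derivative u g"
  shows "locally_integrable g" "locally_integrable u"
proof -
  have "set_integrable lebesgue {a..b} g" for a b
    using assms by (cases "a \<le> b") (auto simp: ac_derivative_def set_integrable_def)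
  moreover have "set_integrable lebesgue {a..b} u" for a b
    using ac_derivative_continuous[OF assms] continuous_on_subset
    by (intro absolutely_integrable_continuous_real) blast
  ultimately show "locally_integrable g" "locally_integrable u" by (auto simp: locally_integrable_def)
qed

lemma ac_derivative_by_parts:
  fixes u g :: "real \<Rightarrow> complex"
  assumes u: "ac_derivative u g" and \<phi>: "test_function \<phi>"
  shows "(\<integral>x. u x * of_real (deriv \<phi> x) \<partial>lebesgue) = - (\<integral>x. g x * of_real (\<phi> x) \<partial>lebesgue)"
proof -
  note \<phi>' = test_function_deriv[OF \<phi>]
  obtain R1 where R1: "R1 > 0" "\<And>x. R1 \<le> \<bar>x\<bar> \<Longrightarrow> \<phi> x = 0" using test_function_support[OF \<phi>] by blast
  obtain R2 where R2: "R2 > 0" "\<And>x. R2 \<le> \<bar>x\<bar> \<Longrightarrow> deriv \<phi> x = 0" using test_function_support[OF \<phi>'] by blast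
  define R where "R = max R1 R2"
  have R: "R > 0" "\<And>x. R \<le> \<bar>x\<bar> \<Longrightarrow> \<phi> x = 0" "\<And>x. R \<le> \<bar>x\<bar> \<Longrightarrow> deriv \<phi> x = 0"
    using R1 R2 by (auto simp: R_def)
  have "ac_derivative (\<lambda>x. complex_of_real (\<phi> x)) (\<lambda>x. complex_of_real (deriv \<phi> x))"
    unfolding ac_derivative_def
  proof (intro allI impI conjI)
    fix a b :: real assume ab: "a \<le> b"
    show "(\<lambda>x. complex_of_real (deriv \<phi> x)) absolutely_integrable_on {a..b}"
      by (intro absolutely_integrable_continuous_real continuous_on_of_real test_function_continuous[OF \<phi>'])
    show "((\<lambda>x. complex_of_real (deriv \<phi> x)) has_integral (complex_of_real (\<phi> b) - complex_of_real (\<phi> a))) {a..b}"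
    proof (rule fundamental_theorem_of_calculus[OF ab])
      fix x
      have "(\<phi> has_real_derivative deriv \<phi> x) (at x within {a..b})"
        using has_field_derivative_at_within[OF test_function_has_derivative[OF \<phi>, of 0 x]] by simp
      then show "((\<lambda>x. complex_of_real (\<phi> x)) has_vector_derivative complex_of_real (deriv \<phi> x)) (at x within {a..b})"
        by (rule has_vector_derivative_of_real)
    qed
  qed
  from ac_derivative_mult[OF u this]
  have "ac_derivative (\<lambda>x. u x * of_real (\<phi> x)) (\<lambda>x. u x * of_real (deriv \<phi> x) + g x * of_real (\<phi> x))" .
  then have ai: "(\<lambda>x. u x * of_real (deriv \<phi> x) + g x * of_real (\<phi> x)) absolutely_integrable_on {-R..R}"
    and hi: "((\<lambda>x. u x * of_real (deriv \<phi> x) + g x * of_real (\<phi> x)) has_integral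
         (u R * of_real (\<phi> R) - u (-R) * of_real (\<phi> (-R)))) {-R..R}"
    using R(1) by (auto simp: ac_derivative_def)
  have "indicator {-R..R} x *\<^sub>R (u x * of_real (deriv \<phi> x) + g x * of_real (\<phi> x))
      = u x * of_real (deriv \<phi> x) + g x * of_real (\<phi> x)" for x
    using R(2,3)[of x] by (cases "R \<le> \<bar>x\<bar>") (auto simp: indicator_def)
  then have "(\<integral>x. u x * of_real (deriv \<phi> x) + g x * of_real (\<phi> x) \<partial>lebesgue) =
      (LINT x:{-R..R}|lebesgue. u x * of_real (deriv \<phi> x) + g x * of_real (\<phi> x))"
    by (simp only: set_lebesgue_integral_def)
  also have "\<dots> = u R * of_real (\<phi> R) - u (-R) * of_real (\<phi> (-R))"
    using set_lebesgue_integral_eq_integral(2)[OF ai] integral_unique[OF hi] by simp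
  also have "\<dots> = 0" using R by simp
  finally have "(\<integral>x. u x * of_real (deriv \<phi> x) + g x * of_real (\<phi> x) \<partial>lebesgue) = 0" .
  then show ?thesis
    using integrable_mult_test[OF ac_derivative_locally_integrable(2)[OF u] \<phi>']
      integrable_mult_test[OF ac_derivative_locally_integrable(1)[OF u] \<phi>]
    by (simp add: eq_neg_iff_add_eq_0)
qed

lemma ac_derivative_cumulative:
  fixes g :: "real \<Rightarrow> 'a::euclidean_space"
  assumes g: "\<And>x. g absolutely_integrable_on {..x}"
  shows "ac_derivative (\<lambda>x. LINT y:{..x}|lebesgue. g y) g"
  unfolding ac_derivative_def
proof (intro allI impI conjI)
  fix a b :: real assume ab: "a \<le> b"
  have sub: "g absolutely_integrable_on S" if "S \<in> sets lebesgue" "S \<subseteq> {..b}" for S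
    using set_integrable_subset[OF g that] .
  show "g absolutely_integrable_on {a..b}" using ab by (intro sub) auto
  have "{..b} = {..a} \<union> {a<..b}" using ab by auto
  moreover have "(LINT y:({..a} \<union> {a<..b})|lebesgue. g y) =
      (LINT y:{..a}|lebesgue. g y) + (LINT y:{a<..b}|lebesgue. g y)"
    using ab by (intro set_integral_Un sub) auto
  ultimately have "(LINT y:{..b}|lebesgue. g y) = (LINT y:{..a}|lebesgue. g y) + (LINT y:{a<..b}|lebesgue. g y)"
    by simp
  moreover have "(g has_integral (LINT y:{a<..b}|lebesgue. g y)) {a<..b}"
    by (intro has_integral_set_lebesgue sub) auto
  then have "(g has_integral (LINT y:{a<..b}|lebesgue. g y)) {a..b}"
    by (rule has_integral_spike_set_eq[THEN iffD1, rotated -1])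
      (auto intro: negligible_subset[of "{a}"])
  ultimately show "(g has_integral ((LINT y:{..b}|lebesgue. g y) - (LINT y:{..a}|lebesgue. g y))) {a..b}"
    by simp
qed

lemma AE_lebesgue_negligible:
  assumes "AE x in lebesgue. P x"
  obtains N where "negligible N" "\<And>x. x \<notin> N \<Longrightarrow> P x"
  using assms
proof (rule AE_E3)
  fix N assume "\<And>x. x \<in> space lebesgue - N \<Longrightarrow> P x" "N \<in> null_sets lebesgue"
  then show thesis by (intro that[of N]) (simp_all add: negligible_iff_null_sets)
qed

lemma ac_derivative_AE_cong:
  assumes u: "ac_derivative u g" and eq: "AE x in lebesgue. g x = h x"
  shows "ac_derivative u h"
proof -
  obtain N where N: "negligible N" "\<And>x. x \<notin> N \<Longrightarrow> g x = h x"
    using AE_lebesgue_negligible[OF eq] by blast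
  show ?thesis
    unfolding ac_derivative_def
  proof (intro allI impI conjI)
    fix a b :: real assume "a \<le> b"
    then have g: "g absolutely_integrable_on {a..b}" "(g has_integral (u b - u a)) {a..b}"
      using u by (auto simp: ac_derivative_def)
    show "h absolutely_integrable_on {a..b}"
      by (rule absolutely_integrable_spike[OF g(1) N(1)]) (simp add: N(2))
    show "(h has_integral (u b - u a)) {a..b}"
      by (rule has_integral_spike[OF N(1) _ g(2)]) (simp add: N(2))
  qed
qed

text \<open>Each order of weak derivative in \<^const>\<open>X_space\<close> is given separately and refers to \<open>f\<close> itself.
  Testing with \<open>\<phi>'\<close> instead of \<open>\<phi>\<close> shows that consecutive ones are weak derivatives of each other.\<close>

lemma is_weak_deriv_next:
  assumes "is_weak_deriv j f g" "is_weak_deriv (Suc j) f g'"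
  shows "is_weak_deriv 1 g g'"
  unfolding is_weak_deriv_def
proof (intro conjI allI impI)
  fix \<phi> assume \<phi>: "test_function \<phi>"
  have "(\<integral>x. f x * of_real ((deriv ^^ j) (deriv \<phi>) x) \<partial>lebesgue) =
      (-1) ^ j * (\<integral>x. g x * of_real (deriv \<phi> x) \<partial>lebesgue)"
    using assms(1) test_function_deriv[OF \<phi>] by (simp add: is_weak_deriv_def)
  moreover have "(\<integral>x. f x * of_real ((deriv ^^ Suc j) \<phi> x) \<partial>lebesgue) =
      (-1) ^ Suc j * (\<integral>x. g' x * of_real (\<phi> x) \<partial>lebesgue)"
    using assms(2) \<phi> by (simp only: is_weak_deriv_def)
  ultimately have "(-1) ^ j * ((\<integral>x. g x * of_real (deriv \<phi> x) \<partial>lebesgue) +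
      (\<integral>x. g' x * of_real (\<phi> x) \<partial>lebesgue)) = 0"
    by (simp only: funpow_Suc_right o_apply power_Suc) (simp add: algebra_simps)
  then have "(\<integral>x. g x * of_real (deriv \<phi> x) \<partial>lebesgue) + (\<integral>x. g' x * of_real (\<phi> x) \<partial>lebesgue) = 0"
    by simp
  then show "(\<integral>x. g x * of_real ((deriv ^^ 1) \<phi> x) \<partial>lebesgue) =
      (-1) ^ 1 * (\<integral>x. g' x * of_real (\<phi> x) \<partial>lebesgue)"
    by (simp add: eq_neg_iff_add_eq_0)
qed (use assms in \<open>auto simp: is_weak_deriv_def\<close>)

lemma is_weak_deriv_0_imp_AE_eq:
  assumes "is_weak_deriv 0 f g"
  shows "AE x in lebesgue. f x = g x"
proof -
  have li: "locally_integrable f" "locally_integrable g" using assms by (auto simp: is_weak_deriv_def)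
  have zero: "(\<integral>x. (f x - g x) * of_real (\<phi> x) \<partial>lebesgue) = 0" if "test_function \<phi>" for \<phi>
    using assms that integrable_mult_test[OF li(1) that] integrable_mult_test[OF li(2) that]
    by (simp add: is_weak_deriv_def algebra_simps)
  obtain k where k: "AE x in lebesgue. f x - g x = k"
    using du_Bois_Reymond[OF locally_integrable_diff[OF li] zero[OF test_function_deriv]] by blast
  let ?\<eta> = "bump 0 1 1"
  have \<eta>: "test_function ?\<eta>" by (rule test_function_bump) auto
  have "0 = (\<integral>x. (f x - g x) * of_real (?\<eta> x) \<partial>lebesgue)" using zero[OF \<eta>] by simp
  also have "\<dots> = (\<integral>x. k * of_real (?\<eta> x) \<partial>lebesgue)"
  proof (rule integral_cong_AE)
    show "AE x in lebesgue. (f x - g x) * of_real (?\<eta> x) = k * of_real (?\<eta> x)"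
      using k by eventually_elim simp
  qed (use integrable_mult_test[OF locally_integrable_diff[OF li] \<eta>]
      integrable_mult_test[OF locally_integrable_const \<eta>] in auto)
  also have "\<dots> = k * of_real (\<integral>x. ?\<eta> x \<partial>lebesgue)" by simp
  finally have "k = 0" using bump_integral_pos[of 0 1 1] by simp
  with k show ?thesis by simp
qed

lemma is_weak_deriv_1_imp_ac_derivative:
  assumes w: "is_weak_deriv 1 f g" and g: "integrable lebesgue g"
  obtains u where "ac_derivative u g" "AE x in lebesgue. f x = u x"
proof -
  have "g absolutely_integrable_on {..x}" for x
    using integrable_mult_indicator[OF _ g] by (simp add: set_integrable_def)
  from ac_derivative_cumulative[OF this] obtain G where G: "ac_derivative G g" by blast
  have li: "locally_integrable f" "locally_integrable G"
    using w ac_derivative_locally_integrable[OF G] by (auto simp: is_weak_deriv_def)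
  obtain k where k: "AE x in lebesgue. f x - G x = k"
  proof (rule du_Bois_Reymond[OF locally_integrable_diff[OF li]])
    fix \<phi> assume \<phi>: "test_function \<phi>"
    have "(\<integral>x. f x * of_real (deriv \<phi> x) \<partial>lebesgue) = (\<integral>x. G x * of_real (deriv \<phi> x) \<partial>lebesgue)"
      using w \<phi> ac_derivative_by_parts[OF G \<phi>] by (simp add: is_weak_deriv_def)
    then show "(\<integral>x. (f x - G x) * of_real (deriv \<phi> x) \<partial>lebesgue) = 0"
      using integrable_mult_test[OF li(1) test_function_deriv[OF \<phi>]]
        integrable_mult_test[OF li(2) test_function_deriv[OF \<phi>]]
      by (simp add: algebra_simps)
  qed
  have "ac_derivative (\<lambda>x. G x + k) g" using G by (simp add: ac_derivative_def)
  moreover have "AE x in lebesgue. f x = G x + k" using k by eventually_elim (simp add: algebra_simps)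
  ultimately show ?thesis using that by blast
qed

lemma weighted_L2_locally_integrable:
  assumes "g \<in> weighted_L2" shows "locally_integrable g"
  using integrable_mult_indicator[OF _ weighted_L2_integrable[OF assms]]
  by (auto simp: locally_integrable_def set_integrable_def)

text \<open>The representative is built from the highest derivative downwards, taking one primitive at a time.\<close>

lemma X_space_imp_X_ac:
  assumes "f \<in> X_space m"
  obtains u where "u \<in> X_ac m" "AE x in lebesgue. f x = u x"
proof -
  have "\<exists>g. is_weak_deriv j f g \<and> g \<in> weighted_L2" if "j \<le> m" for j
    using assms that by (auto simp: X_space_def weighted_L2_def)
  then obtain g where g: "\<And>j. j \<le> m \<Longrightarrow> is_weak_deriv j f (g j)" "\<And>j. j \<le> m \<Longrightarrow> g j \<in> weighted_L2"
    by metis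
  have "\<exists>u\<in>X_ac k. AE x in lebesgue. g (m - k) x = u x" if "k \<le> m" for k
    using that
  proof (induction k)
    case 0
    then show ?case using g(2)[of m] by auto
  next
    case (Suc k)
    then obtain v where v: "v \<in> X_ac k" "AE x in lebesgue. g (m - k) x = v x" by auto
    have mk: "m - k = Suc (m - Suc k)" using Suc.prems by simp
    have "is_weak_deriv 1 (g (m - Suc k)) (g (m - k))"
      using is_weak_deriv_next[OF g(1)[of "m - Suc k"] g(1)[of "Suc (m - Suc k)"]] Suc.prems by (simp add: mk)
    then obtain u where u: "ac_derivative u (g (m - k))" "AE x in lebesgue. g (m - Suc k) x = u x"
      using is_weak_deriv_1_imp_ac_derivative weighted_L2_integrable[OF g(2)[of "m - k"]] by (metis diff_le_self)
    have "ac_derivative u v" by (rule ac_derivative_AE_cong[OF u(1) v(2)])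
    moreover have "u \<in> weighted_L2" using weighted_L2_AE_cong[OF g(2) u(2)] by simp
    ultimately have "u \<in> X_ac (Suc k)" using v(1) by (intro X_ac_SucI)
    with u(2) show ?case by blast
  qed
  from this[of m] obtain u where u: "u \<in> X_ac m" "AE x in lebesgue. g 0 x = u x" by auto
  moreover have "AE x in lebesgue. f x = g 0 x" using is_weak_deriv_0_imp_AE_eq[OF g(1)[of 0]] by simp
  then have "AE x in lebesgue. f x = u x" using u(2) by eventually_elim simp
  ultimately show ?thesis using that by blast
qed

text \<open>Integration by parts, once for each order.\<close>

lemma X_ac_weak_derivative:
  assumes "u \<in> X_ac k" "j \<le> k"
  obtains g where "g \<in> weighted_L2" "is_weak_deriv j u g"
proof -
  have "\<exists>g\<in>weighted_L2. \<forall>\<phi>. test_function \<phi> \<longrightarrow>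
      (\<integral>x. u x * of_real ((deriv ^^ j) \<phi> x) \<partial>lebesgue) = (-1) ^ j * (\<integral>x. g x * of_real (\<phi> x) \<partial>lebesgue)"
    using assms
  proof (induction j arbitrary: u k)
    case 0
    then show ?case by (auto dest: X_ac_weighted_L2)
  next
    case (Suc j)
    obtain k' where k: "k = Suc k'" "j \<le> k'" using Suc.prems(2) by (cases k) auto
    then obtain v where v: "v \<in> X_ac k'" "ac_derivative u v" using Suc.prems(1) by auto
    from Suc.IH[OF v(1) k(2)] obtain g where g: "g \<in> weighted_L2" and IH: "\<And>\<phi>. test_function \<phi> \<Longrightarrow>
      (\<integral>x. v x * of_real ((deriv ^^ j) \<phi> x) \<partial>lebesgue) = (-1) ^ j * (\<integral>x. g x * of_real (\<phi> x) \<partial>lebesgue)"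
      by blast
    have "(\<integral>x. u x * of_real ((deriv ^^ Suc j) \<phi> x) \<partial>lebesgue) = (-1) ^ Suc j * (\<integral>x. g x * of_real (\<phi> x) \<partial>lebesgue)"
      if "test_function \<phi>" for \<phi>
      using ac_derivative_by_parts[OF v(2) test_function_deriv_iterate[OF that, of j]] IH[OF that] by simp
    with g show ?case by blast
  qed
  then show ?thesis
    using that weighted_L2_locally_integrable X_ac_weighted_L2[OF assms(1)] by (auto simp: is_weak_deriv_def)
qed

lemma is_weak_deriv_AE_cong:
  assumes "is_weak_deriv j u g" "AE x in lebesgue. u x = f x"
  shows "is_weak_deriv j f g"
  unfolding is_weak_deriv_def
proof (intro conjI allI impI)
  have u: "locally_integrable u" and g: "locally_integrable g"
    using assms(1) by (auto simp: is_weak_deriv_def)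
  have "integrable lebesgue (\<lambda>x. indicator {a..b} x *\<^sub>R f x)" for a b :: real
  proof -
    have int: "integrable lebesgue (\<lambda>x. indicator {a..b} x *\<^sub>R u x)"
      using u by (auto simp: locally_integrable_def set_integrable_def)
    have ae: "AE x in lebesgue. indicator {a..b} x *\<^sub>R u x = indicator {a..b} x *\<^sub>R f x"
      using assms(2) by eventually_elim simp
    have "(\<lambda>x. indicator {a..b} x *\<^sub>R f x) \<in> borel_measurable lebesgue"
      by (rule borel_measurable_AE[OF _ ae]) (use int in auto)
    from integrable_cong_AE_imp[OF int this ae] show ?thesis .
  qed
  then show f: "locally_integrable f" by (simp add: locally_integrable_def set_integrable_def)
  show "locally_integrable g" by (rule g)
  fix \<phi> assume \<phi>: "test_function \<phi>"
  note t = test_function_deriv_iterate[OF \<phi>, of j]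
  have "(\<integral>x. f x * of_real ((deriv ^^ j) \<phi> x) \<partial>lebesgue) = (\<integral>x. u x * of_real ((deriv ^^ j) \<phi> x) \<partial>lebesgue)"
  proof (rule integral_cong_AE)
    show "AE x in lebesgue. f x * of_real ((deriv ^^ j) \<phi> x) = u x * of_real ((deriv ^^ j) \<phi> x)"
      using assms(2) by eventually_elim simp
  qed (use integrable_mult_test[OF f t] integrable_mult_test[OF u t] in auto)
  then show "(\<integral>x. f x * of_real ((deriv ^^ j) \<phi> x) \<partial>lebesgue) = (-1) ^ j * (\<integral>x. g x * of_real (\<phi> x) \<partial>lebesgue)"
    using assms(1) \<phi> by (simp add: is_weak_deriv_def)
qed

lemma X_ac_imp_X_space:
  assumes u: "u \<in> X_ac m" and eq: "AE x in lebesgue. u x = f x"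
  shows "f \<in> X_space m"
proof -
  have "f \<in> L2"
    using weighted_L2_imp_L2[OF weighted_L2_AE_cong[OF X_ac_weighted_L2[OF u] eq]] .
  moreover have "\<exists>g. is_weak_deriv j f g \<and> g \<in> weighted_L2" if "j \<le> m" for j
    using X_ac_weak_derivative[OF u that] is_weak_deriv_AE_cong[OF _ eq] by metis
  ultimately show ?thesis by (auto simp: X_space_def weighted_L2_def)
qed

section \<open>Composition with the hodograph flow\<close>

text \<open>The inverse of an expanding map is a contraction, and Lipschitz images of null sets are null.\<close>

lemma negligible_vimage_expanding:
  fixes \<Phi> :: "real \<Rightarrow> real"
  assumes expand: "\<And>x y. x \<le> y \<Longrightarrow> y - x \<le> \<Phi> y - \<Phi> x" and N: "negligible N"
  shows "negligible (\<Phi> -` N)"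
proof -
  have le: "\<bar>b - a\<bar> \<le> \<bar>\<Phi> b - \<Phi> a\<bar>" for a b
    using expand[of a b] expand[of b a] by linarith
  have inj: "inj \<Phi>"
  proof (rule injI)
    show "x = y" if "\<Phi> x = \<Phi> y" for x y using le[of x y] that by simp
  qed
  have "negligible (inv \<Phi> ` (N \<inter> range \<Phi>))"
  proof (rule negligible_locally_Lipschitz_image)
    show "negligible (N \<inter> range \<Phi>)" using N by (rule negligible_subset) auto
    fix x assume "x \<in> N \<inter> range \<Phi>"
    then obtain a where a: "x = \<Phi> a" by blast
    have "norm (inv \<Phi> y - inv \<Phi> x) \<le> 1 * norm (y - x)" if y: "y \<in> range \<Phi>" for y
    proof -
      obtain b where "y = \<Phi> b" using y by blast
      then show ?thesis using le[where a = a and b = b] by (simp add: a inv_f_f[OF inj])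
    qed
    then have "\<forall>y\<in>(N \<inter> range \<Phi>) \<inter> UNIV. norm (inv \<Phi> y - inv \<Phi> x) \<le> 1 * norm (y - x)"
      by blast
    then show "\<exists>T B. open T \<and> x \<in> T \<and> (\<forall>y\<in>(N \<inter> range \<Phi>) \<inter> T. norm (inv \<Phi> y - inv \<Phi> x) \<le> B * norm (y - x))"
      by (intro exI[of _ UNIV] exI[of _ 1]) simp
  qed simp
  moreover have "\<Phi> -` N \<subseteq> inv \<Phi> ` (N \<inter> range \<Phi>)"
  proof
    fix x assume "x \<in> \<Phi> -` N"
    then show "x \<in> inv \<Phi> ` (N \<inter> range \<Phi>)"
      by (intro image_eqI[of _ _ "\<Phi> x"]) (auto simp: inv_f_f[OF inj])
  qed
  ultimately show ?thesis by (rule negligible_subset)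
qed

text \<open>The shift satisfies \<open>\<epsilon>' = sqrt (1 + |q \<circ> \<Phi>|\<^sup>2) - 1\<close> in the integrated sense.  Since \<open>q \<circ> \<Phi>\<close> and
  \<open>u \<circ> \<Phi>\<close> differ on a null set only, the integrand may be taken continuous, and then \<open>\<epsilon>\<close> is
  differentiable everywhere.\<close>

lemma hodograph_shift_smooth:
  assumes hs: "hodograph_shift q \<epsilon>" and u: "continuous_on UNIV u" and eq: "AE x in lebesgue. q x = u x"
  shows "((\<lambda>x. x + \<epsilon> x) has_real_derivative sqrt (1 + (cmod (u (x + \<epsilon> x)))\<^sup>2)) (at x)"
    and "AE x in lebesgue. q (x + \<epsilon> x) = u (x + \<epsilon> x)"
proof -
  let ?F = "\<lambda>y. sqrt (1 + (cmod (q (y + \<epsilon> y)))\<^sup>2) - 1"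
  let ?G = "\<lambda>y. sqrt (1 + (cmod (u (y + \<epsilon> y)))\<^sup>2) - 1"
  have mono: "mono \<epsilon>" and cont: "continuous_on UNIV \<epsilon>"
    and F: "\<And>x. ?F absolutely_integrable_on {..x}" "\<And>x. \<epsilon> x = (LINT y:{..x}|lebesgue. ?F y)"
    using hs unfolding hodograph_shift_def by blast+
  obtain N where N: "negligible N" "\<And>x. x \<notin> N \<Longrightarrow> q x = u x"
    using AE_lebesgue_negligible[OF eq] by blast
  have "negligible ((\<lambda>x. x + \<epsilon> x) -` N)"
  proof (rule negligible_vimage_expanding[OF _ N(1)])
    fix x y :: real assume "x \<le> y"
    from monoD[OF mono this] show "y - x \<le> y + \<epsilon> y - (x + \<epsilon> x)" by simp
  qed
  then have "AE x in lebesgue. x \<notin> (\<lambda>x. x + \<epsilon> x) -` N"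
    by (intro AE_not_in) (simp add: negligible_iff_null_sets)
  then show ae: "AE x in lebesgue. q (x + \<epsilon> x) = u (x + \<epsilon> x)"
    by eventually_elim (use N(2) in auto)
  have "(\<lambda>x. LINT y:{..x}|lebesgue. ?F y) = \<epsilon>" by (intro ext F(2)[symmetric])
  from subst[OF this, of "\<lambda>e. ac_derivative e ?F", OF ac_derivative_cumulative[OF F(1)]]
  have "ac_derivative \<epsilon> ?F" .
  moreover have "AE x in lebesgue. ?F x = ?G x" using ae by eventually_elim simp
  ultimately have acG: "ac_derivative \<epsilon> ?G" by (rule ac_derivative_AE_cong)
  have "(\<epsilon> has_real_derivative ?G x) (at x)"
  proof -
    have "continuous_on {x-1..x+1} ?G"
      by (intro continuous_intros continuous_on_compose2[OF u] continuous_on_subset[OF cont]) auto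
    then have "((\<lambda>y. integral {x-1..y} ?G) has_real_derivative ?G x) (at x within {x-1..x+1})"
      by (rule integral_has_real_derivative) simp
    from DERIV_add[OF DERIV_const[of "\<epsilon> (x - 1)"] this]
    have "((\<lambda>y. \<epsilon> (x - 1) + integral {x-1..y} ?G) has_real_derivative ?G x) (at x within {x-1..x+1})"
      by simp
    then have "(\<epsilon> has_real_derivative ?G x) (at x within {x-1..x+1})"
    proof (rule has_field_derivative_transform_within[where d = 1])
      fix y assume "y \<in> {x-1..x+1}"
      then show "\<epsilon> (x - 1) + integral {x-1..y} ?G = \<epsilon> y"
        by (intro ac_derivative_eq[OF acG, symmetric]) simp
    qed simp_all
    then show ?thesis using at_within_Icc_at[of "x - 1" x "x + 1"] by simp
  qed
  from DERIV_add[OF DERIV_ident this]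
  show "((\<lambda>x. x + \<epsilon> x) has_real_derivative sqrt (1 + (cmod (u (x + \<epsilon> x)))\<^sup>2)) (at x)"
    by simp
qed

text \<open>From \<open>x = \<Phi> x + (x - \<Phi> x)\<close> one gets \<open>1 + x\<^sup>2 \<le> (2 + 2 M\<^sup>2) (1 + (\<Phi> x)\<^sup>2)\<close>, and \<open>p \<ge> 1\<close> allows the
  Jacobian to be inserted, which turns the weighted integral of \<open>|g \<circ> \<Phi>|\<^sup>2\<close> into that of \<open>|g|\<^sup>2\<close>.
  Composition preserves Lebesgue measurability because preimages of null sets are null.\<close>

lemma weighted_L2_compose:
  fixes \<Phi> p :: "real \<Rightarrow> real"
  assumes \<Phi>: "\<And>x. (\<Phi> has_real_derivative p x) (at x)" and p: "\<And>x. p x \<ge> 1"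
    and M: "\<And>x. \<bar>\<Phi> x - x\<bar> \<le> M" and bij: "bij \<Phi>"
    and g: "g \<in> weighted_L2"
  shows "(\<lambda>x. g (\<Phi> x)) \<in> weighted_L2"
proof -
  have cont: "continuous_on UNIV \<Phi>" using DERIV_isCont[OF \<Phi>] by (simp add: continuous_at_imp_continuous_on)
  have expand: "y - x \<le> \<Phi> y - \<Phi> x" if "x \<le> y" for x y
  proof (cases "x = y")
    case False
    with that have "x < y" by simp
    then obtain z where "\<Phi> y - \<Phi> x = (y - x) * p z"
      using MVT2[of x y \<Phi> p] \<Phi> by blast
    then show ?thesis using p[of z] that mult_left_mono[of 1 "p z" "y - x"] by simp
  qed simp
  have meas: "(\<lambda>x. g (\<Phi> x)) \<in> borel_measurable lebesgue"
  proof -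
    have "g measurable_on UNIV"
      using g by (intro lebesgue_measurable_imp_measurable_on) (auto simp: weighted_L2_iff)
    then obtain N \<gamma> where N: "negligible N" and \<gamma>: "\<And>n. continuous_on UNIV (\<gamma> n)"
      and lim: "\<And>x. x \<notin> N \<Longrightarrow> (\<lambda>n. \<gamma> n x) \<longlonglongrightarrow> g x"
      unfolding measurable_on_def by auto
    have "(\<lambda>x. g (\<Phi> x)) measurable_on UNIV"
      unfolding measurable_on_def
    proof (intro exI[of _ "\<Phi> -` N"] exI[of _ "\<lambda>n x. \<gamma> n (\<Phi> x)"] conjI allI impI)
      show "negligible (\<Phi> -` N)" by (rule negligible_vimage_expanding[OF expand N])
      show "continuous_on UNIV (\<lambda>x. \<gamma> n (\<Phi> x))" for n
        using continuous_on_compose2[OF \<gamma> cont] by simp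
    qed (use lim in auto)
    then show ?thesis by (simp add: measurable_on_iff_borel_measurable)
  qed
  define f where "f y = (1 + y\<^sup>2) * (cmod (g y))\<^sup>2" for y
  have "f absolutely_integrable_on range \<Phi>"
    using g bij by (simp add: weighted_L2_iff f_def[abs_def] set_integrable_def bij_is_surj)
  then have "(\<lambda>x. \<bar>p x\<bar> *\<^sub>R f (\<Phi> x)) absolutely_integrable_on UNIV"
    using absolutely_integrable_change_of_variables_real[of UNIV \<Phi> p f] \<Phi> bij_is_inj[OF bij] by simp
  then have int: "integrable lebesgue (\<lambda>x. p x * f (\<Phi> x))"
  proof -
    have "\<bar>p x\<bar> *\<^sub>R f (\<Phi> x) = p x * f (\<Phi> x)" for x using p[of x] by simp
    with \<open>(\<lambda>x. \<bar>p x\<bar> *\<^sub>R f (\<Phi> x)) absolutely_integrable_on UNIV\<close>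
    show ?thesis by (simp only: set_integrable_def) simp
  qed
  define C where "C = 2 + 2 * M\<^sup>2"
  show ?thesis
  proof (rule weighted_L2_dominated[OF meas])
    have pos: "1 + x\<^sup>2 > 0" for x :: real by (simp add: add_pos_nonneg)
    have "integrable lebesgue (\<lambda>x. C * (p x * f (\<Phi> x)))" using int by (rule integrable_mult_right)
    then show "integrable lebesgue (\<lambda>x. (1 + x\<^sup>2) * (C * (p x * f (\<Phi> x)) / (1 + x\<^sup>2)))"
      using pos by (simp add: less_imp_neq[symmetric])
    have "(cmod (g (\<Phi> x)))\<^sup>2 \<le> C * (p x * f (\<Phi> x)) / (1 + x\<^sup>2)" for x
    proof -
      define G where "G = (cmod (g (\<Phi> x)))\<^sup>2"
      have "(\<Phi> x - x)\<^sup>2 \<le> M\<^sup>2" using M[of x] by (simp add: abs_le_square_iff[symmetric])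
      moreover have "x\<^sup>2 \<le> 2 * (\<Phi> x)\<^sup>2 + 2 * (\<Phi> x - x)\<^sup>2"
        using zero_le_power2[of "2 * \<Phi> x - x"] by (simp add: power2_eq_square algebra_simps)
      ultimately have "1 + x\<^sup>2 \<le> (2 + 2 * M\<^sup>2) + 2 * (\<Phi> x)\<^sup>2" by simp
      also have "\<dots> \<le> C * (1 + (\<Phi> x)\<^sup>2)" by (simp add: C_def algebra_simps)
      also have "\<dots> \<le> C * (1 + (\<Phi> x)\<^sup>2) * p x"
        using mult_left_mono[OF p[of x], of "C * (1 + (\<Phi> x)\<^sup>2)"] by (simp add: C_def)
      finally have "(1 + x\<^sup>2) * G \<le> C * (1 + (\<Phi> x)\<^sup>2) * p x * G"
        by (rule mult_right_mono) (simp add: G_def)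
      then show ?thesis
        using pos[of x] by (simp add: f_def G_def[symmetric] pos_le_divide_eq mult_ac)
    qed
    then show "AE x in lebesgue. (cmod (g (\<Phi> x)))\<^sup>2 \<le> C * (p x * f (\<Phi> x)) / (1 + x\<^sup>2)" by simp
  qed
qed

lemma ac_derivative_substitution:
  fixes \<Phi> p :: "real \<Rightarrow> real"
  assumes \<Phi>: "\<And>x. (\<Phi> has_real_derivative p x) (at x)" and p: "\<And>x. p x > 0"
    and u: "ac_derivative u g"
  shows "ac_derivative (\<lambda>x. u (\<Phi> x)) (\<lambda>x. p x *\<^sub>R g (\<Phi> x))"
  unfolding ac_derivative_def
proof (intro allI impI)
  fix a b :: real assume ab: "a \<le> b"
  have sm: "strict_mono \<Phi>"
  proof (rule strict_monoI)
    fix x y :: real assume "x < y"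
    then show "\<Phi> x < \<Phi> y"
    proof (rule DERIV_pos_imp_increasing)
      show "\<exists>d. (\<Phi> has_real_derivative d) (at z) \<and> d > 0" for z
        using \<Phi>[of z] p[of z] by blast
    qed
  qed
  have cont: "continuous_on {a..b} \<Phi>" using DERIV_isCont[OF \<Phi>] by (simp add: continuous_at_imp_continuous_on)
  have img: "\<Phi> ` {a..b} = {\<Phi> a..\<Phi> b}"
  proof
    show "\<Phi> ` {a..b} \<subseteq> {\<Phi> a..\<Phi> b}" using sm by (auto simp: strict_mono_less_eq)
    show "{\<Phi> a..\<Phi> b} \<subseteq> \<Phi> ` {a..b}"
    proof
      fix y assume "y \<in> {\<Phi> a..\<Phi> b}"
      then obtain x where "a \<le> x" "x \<le> b" "\<Phi> x = y" using IVT'[of \<Phi> a y b] ab cont by auto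
      then show "y \<in> \<Phi> ` {a..b}" by auto
    qed
  qed
  have le: "\<Phi> a \<le> \<Phi> b" using sm ab by (simp add: strict_mono_less_eq)
  have "g absolutely_integrable_on \<Phi> ` {a..b} \<and> integral (\<Phi> ` {a..b}) g = u (\<Phi> b) - u (\<Phi> a)"
    unfolding img using u le integral_unique unfolding ac_derivative_def by blast
  moreover have "(\<lambda>x. \<bar>p x\<bar> *\<^sub>R g (\<Phi> x)) absolutely_integrable_on {a..b} \<and>
      integral {a..b} (\<lambda>x. \<bar>p x\<bar> *\<^sub>R g (\<Phi> x)) = u (\<Phi> b) - u (\<Phi> a) \<longleftrightarrow>
      g absolutely_integrable_on \<Phi> ` {a..b} \<and> integral (\<Phi> ` {a..b}) g = u (\<Phi> b) - u (\<Phi> a)"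
  proof (rule has_absolute_integral_change_of_variables_real)
    show "(\<Phi> has_real_derivative p x) (at x within {a..b})" for x
      by (rule has_field_derivative_at_within[OF \<Phi>])
    show "inj_on \<Phi> {a..b}" by (simp add: inj_on_def strict_mono_eq[OF sm])
  qed simp
  moreover have "\<bar>p x\<bar> = p x" for x using p[of x] by simp
  ultimately have *: "(\<lambda>x. p x *\<^sub>R g (\<Phi> x)) absolutely_integrable_on {a..b}"
      "integral {a..b} (\<lambda>x. p x *\<^sub>R g (\<Phi> x)) = u (\<Phi> b) - u (\<Phi> a)"
    by simp_all
  show "(\<lambda>x. p x *\<^sub>R g (\<Phi> x)) absolutely_integrable_on {a..b} \<and>
      ((\<lambda>x. p x *\<^sub>R g (\<Phi> x)) has_integral (u (\<Phi> b) - u (\<Phi> a))) {a..b}"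
    using * set_lebesgue_integral_eq_integral(1)[OF *(1)] unfolding has_integral_iff by blast
qed

text \<open>The equation \<open>\<Phi>' = s \<circ> \<Phi>\<close> gives \<open>(u \<circ> \<Phi>)' = (s u') \<circ> \<Phi>\<close>, and the induction hypothesis applies
  to \<open>s u'\<close>.\<close>

lemma X_ac_compose_flow:
  fixes \<Phi> s :: "real \<Rightarrow> real"
  assumes \<Phi>: "\<And>x. (\<Phi> has_real_derivative s (\<Phi> x)) (at x)" and s: "\<And>x. s x \<ge> 1"
    and M: "\<And>x. \<bar>\<Phi> x - x\<bar> \<le> M" and bij: "bij \<Phi>"
    and mult: "(\<lambda>x. complex_of_real (s x)) \<in> X_multiplier n"
  shows "k \<le> Suc n \<Longrightarrow> u \<in> X_ac k \<Longrightarrow> (\<lambda>x. u (\<Phi> x)) \<in> X_ac k"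
proof (induction k arbitrary: u)
  case 0
  then show ?case using weighted_L2_compose[OF \<Phi> s M bij] by simp
next
  case (Suc k)
  then obtain g where g: "g \<in> X_ac k" "ac_derivative u g" by auto
  have "k - 1 \<le> n" using Suc.prems(1) by simp
  from X_multiplier_mono[OF this] mult have "(\<lambda>x. complex_of_real (s x)) \<in> X_multiplier (k - 1)" by blast
  then have "(\<lambda>x. complex_of_real (s x) * g x) \<in> X_ac k" using g(1) by (rule X_ac_multiplier_mult)
  then have "(\<lambda>x. complex_of_real (s (\<Phi> x)) * g (\<Phi> x)) \<in> X_ac k"
    using Suc.IH[of "\<lambda>x. complex_of_real (s x) * g x"] Suc.prems(1) by simp
  moreover have "ac_derivative (\<lambda>x. u (\<Phi> x)) (\<lambda>x. complex_of_real (s (\<Phi> x)) * g (\<Phi> x))"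
    using ac_derivative_substitution[OF \<Phi> less_le_trans[OF zero_less_one s] g(2)]
    by (simp add: scaleR_conv_of_real)
  moreover have "(\<lambda>x. u (\<Phi> x)) \<in> weighted_L2"
    using weighted_L2_compose[OF \<Phi> s M bij] X_ac_weighted_L2[OF Suc.prems(2)] by blast
  ultimately show ?case by (intro X_ac_SucI)
qed

lemma X_space_hodograph:
  assumes m: "m \<ge> 1" and q: "q \<in> X_space m" and hs: "hodograph_shift q \<epsilon>"
  shows "(\<lambda>x. q (x + \<epsilon> x)) \<in> X_space m"
proof -
  obtain n where n: "m = Suc n" using m by (cases m) auto
  obtain u where u: "u \<in> X_ac m" "AE x in lebesgue. q x = u x" using X_space_imp_X_ac[OF q] by blast
  have u_cont: "continuous_on UNIV u" using u(1) ac_derivative_continuous by (auto simp: n)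
  define \<Phi> where "\<Phi> x = x + \<epsilon> x" for x
  define s where "s x = sqrt (1 + (cmod (u x))\<^sup>2)" for x
  have \<Phi>: "(\<Phi> has_real_derivative s (\<Phi> x)) (at x)" for x
    using hodograph_shift_smooth(1)[OF hs u_cont u(2)] by (simp add: \<Phi>_def[abs_def] s_def)
  have ae: "AE x in lebesgue. u (\<Phi> x) = q (\<Phi> x)"
    using hodograph_shift_smooth(2)[OF hs u_cont u(2)] by (simp add: \<Phi>_def eq_commute)
  have s: "s x \<ge> 1" for x by (simp add: s_def)
  obtain M where M: "\<And>x. \<bar>\<Phi> x - x\<bar> \<le> M"
  proof -
    have "bounded (range \<epsilon>)" using hs unfolding hodograph_shift_def by blast
    then show ?thesis using that by (auto simp: bounded_iff \<Phi>_def)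
  qed
  have cont: "continuous_on UNIV \<Phi>" using DERIV_isCont[OF \<Phi>] by (simp add: continuous_at_imp_continuous_on)
  have "bij \<Phi>"
  proof (rule bijI)
    show "inj \<Phi>"
    proof (rule strict_mono_imp_inj_on, rule strict_monoI)
      fix x y :: real assume "x < y"
      then show "\<Phi> x < \<Phi> y"
      proof (rule DERIV_pos_imp_increasing)
        show "\<exists>d. (\<Phi> has_real_derivative d) (at z) \<and> d > 0" for z
          using \<Phi>[of z] less_le_trans[OF zero_less_one s] by blast
      qed
    qed
    show "surj \<Phi>"
      unfolding surj_def
    proof
      fix y
      have "M \<ge> 0" using M[of 0] by simp
      have "\<Phi> (y - M) \<le> y" "y \<le> \<Phi> (y + M)" using M[of "y - M"] M[of "y + M"] by auto
      then obtain x where "\<Phi> x = y"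
        using IVT'[of \<Phi> "y - M" y "y + M"] \<open>M \<ge> 0\<close> continuous_on_subset[OF cont subset_UNIV] by auto
      then show "\<exists>x. y = \<Phi> x" by blast
    qed
  qed
  have "(\<lambda>x. u (\<Phi> x)) \<in> X_ac m"
    using X_ac_compose_flow[OF \<Phi> s M \<open>bij \<Phi>\<close> _ _ u(1), of n] X_multiplier_sqrt[of u n] u(1) by (simp add: n s_def)
  from X_ac_imp_X_space[OF this ae] show ?thesis by (simp add: \<Phi>_def)
qed

theorem theorem3:
  fixes m :: nat
  assumes "m \<ge> 1"
  shows "\<exists>\<delta>>0. \<forall>(r :: real \<Rightarrow> complex) (\<mu> :: real \<Rightarrow> real \<Rightarrow> real \<Rightarrow> complex^2^2)
            (qH :: real \<Rightarrow> real \<Rightarrow> complex) (\<epsilon> :: real \<Rightarrow> real \<Rightarrow> real).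
     (\<forall>j::int. -1 \<le> j \<and> j \<le> int m + 1 \<longrightarrow> (\<lambda>l. of_real (l powi j) * r (1 / l)) \<in> H1) \<longrightarrow>
     L2_norm (\<lambda>l. of_real (1 / l) * r (1 / l)) + L2_norm (\<lambda>l. r (1 / l)) < \<delta> \<longrightarrow>
     (\<forall>x. \<forall>t\<ge>0. RH_solution r x t (\<mu> x t)) \<longrightarrow>
     (\<forall>t\<ge>0. (\<lambda>x. qH x t) \<in> X_space m \<and>
        (\<forall>x. ((\<lambda>x'. RH_m1 r x' t (\<mu> x' t) $ 1 $ 2) has_vector_derivative
               qH x t / of_real (sqrt (1 + (cmod (qH x t))\<^sup>2))) (at x))) \<longrightarrow>
     (\<forall>t\<ge>0. hodograph_shift (\<lambda>x. qH x t) (\<lambda>x. \<epsilon> x t)) \<longrightarrow>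
     (\<forall>t\<ge>0. (\<lambda>x. qH (x + \<epsilon> x t) t) \<in> X_space m)"
proof (intro exI[of _ "1::real"] conjI allI impI)
  fix r :: "real \<Rightarrow> complex" and \<mu> :: "real \<Rightarrow> real \<Rightarrow> real \<Rightarrow> complex^2^2"
    and qH :: "real \<Rightarrow> real \<Rightarrow> complex" and \<epsilon> :: "real \<Rightarrow> real \<Rightarrow> real" and t :: real
  assume "\<forall>t\<ge>0. (\<lambda>x. qH x t) \<in> X_space m \<and>
        (\<forall>x. ((\<lambda>x'. RH_m1 r x' t (\<mu> x' t) $ 1 $ 2) has_vector_derivative
               qH x t / of_real (sqrt (1 + (cmod (qH x t))\<^sup>2))) (at x))"
    and "\<forall>t\<ge>0. hodograph_shift (\<lambda>x. qH x t) (\<lambda>x. \<epsilon> x t)" and "0 \<le> t"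
  then have "(\<lambda>x. qH x t) \<in> X_space m" "hodograph_shift (\<lambda>x. qH x t) (\<lambda>x. \<epsilon> x t)"
    by blast+
  then show "(\<lambda>x. qH (x + \<epsilon> x t) t) \<in> X_space m"
    by (rule X_space_hodograph[OF assms])
qed simp

end
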